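(* Let $(m_j)_{j=1}^{\infty}$ be a strictly increasing sequence of positive integers with $m_{j+1}\ge q\,m_j$ for all $j$, where $q\ge 2$, and let $p>0$. Let $A_j>0$, $B_j\in\mathbb{C}$ satisfy $A_j^2-|B_j|^2=1$ for all $j$. For $N\in\mathbb{N}$ let $g_N\colon\mathbb{T}\to\mathrm{SU}(1,1)$ be the partial product $$g_N(t)=\prod_{j=1}^{N}\begin{bmatrix} A_j & B_j e^{2\pi i m_j t}\\ \overline{B_j}e^{-2\pi i m_j t} & A_j\end{bmatrix}$$ (factors multiplied in increasing order of $j$ from left to right). Then the sequence $(g_N)_{N\in\mathbb{N}}$ converges in the metric space $(\mathrm{L}^p(\mathbb{T},\mathrm{SU}(1,1)),d_p)$ if and only if $\sum_{j=1}^{\infty}\log(A_j^2+|B_j|^2)<\infty$.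
   Context: $\mathbb{T}=\mathbb{R}/\mathbb{Z}$ with Lebesgue measure. $\mathrm{SU}(1,1)=\{\begin{bmatrix} A & B\\ \overline{B} & \overline{A}\end{bmatrix}: A,B\in\mathbb{C},\ |A|^2-|B|^2=1\}$. On $\mathrm{SU}(1,1)$ define the metric $\rho(G_1,G_2)=\log(1+\|G_1^{-1}G_2-I_2\|_{op})$, where $\|\cdot\|_{op}$ is the operator (spectral) norm and $I_2$ the $2\times 2$ identity. For measurable $g_1,g_2\colon\mathbb{T}\to\mathrm{SU}(1,1)$ (identified when equal a.e.), set $d_p(g_1,g_2)=\|\rho(g_1(t),g_2(t))\|_{\mathrm{L}^p_t(\mathbb{T})}$ if $p\ge1$ and $d_p(g_1,g_2)=\|\rho(g_1(t),g_2(t))\|_{\mathrm{L}^p_t(\mathbb{T})}^p$ if $0<p<1$. Let $I(t)=I_2$ for all $t$, and $\mathrm{L}^p(\mathbb{T},\mathrm{SU}(1,1))$ the set of measurable $g\colon\mathbb{T}\to\mathrm{SU}(1,1)$ with $d_p(I,g)<\infty$; it is a complete metric space with metric $d_p$. The condition $\sum_j\log(A_j^2+|B_j|^2)<\infty$ is referred to as the product having $\ell^2$ coefficients (equivalently $\sum_j|B_j|^2<\infty$). *)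

theory Defs
  imports "HOL-Analysis.Analysis"
begin

type_synonym cmat2 = "complex^2^2"

definition SU11 :: "cmat2 set" where
  "SU11 = {M. M$2$1 = cnj (M$1$2) \<and> M$2$2 = cnj (M$1$1) \<and>
              (cmod (M$1$1))^2 - (cmod (M$1$2))^2 = 1}"

definition opnorm :: "cmat2 \<Rightarrow> real" where
  "opnorm M = onorm (\<lambda>x::complex^2. M *v x)"

definition rho :: "cmat2 \<Rightarrow> cmat2 \<Rightarrow> real" where
  "rho G1 G2 = ln (1 + opnorm (matrix_inv G1 ** G2 - mat 1))"

text \<open>The torus T = R/Z is represented by [0,1) with Lebesgue measure; functions
  on T are functions real => cmat2 considered on [0,1).\<close>
definition rho_int :: "real \<Rightarrow> (real \<Rightarrow> cmat2) \<Rightarrow> (real \<Rightarrow> cmat2) \<Rightarrow> ennreal" where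
  "rho_int p g1 g2 = (\<integral>\<^sup>+ t. ennreal (rho (g1 t) (g2 t) powr p) \<partial>(lebesgue_on {0..<1}))"

definition d_p :: "real \<Rightarrow> (real \<Rightarrow> cmat2) \<Rightarrow> (real \<Rightarrow> cmat2) \<Rightarrow> ennreal" where
  "d_p p g1 g2 = (if p \<ge> 1 then
      (if rho_int p g1 g2 = \<infinity> then \<infinity> else ennreal ((enn2real (rho_int p g1 g2)) powr (1/p)))
    else rho_int p g1 g2)"

definition Id_fun :: "real \<Rightarrow> cmat2" where
  "Id_fun t = mat 1"

definition in_Lp :: "real \<Rightarrow> (real \<Rightarrow> cmat2) \<Rightarrow> bool" where
  "in_Lp p g \<longleftrightarrow> g \<in> borel_measurable (lebesgue_on {0..<1}) \<and>
      (\<forall>t\<in>{0..<1}. g t \<in> SU11) \<and> d_p p Id_fun g < \<infinity>"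

definition Lp_convergent :: "real \<Rightarrow> (nat \<Rightarrow> real \<Rightarrow> cmat2) \<Rightarrow> bool" where
  "Lp_convergent p G \<longleftrightarrow> (\<exists>g. in_Lp p g \<and> (\<lambda>N. d_p p (G N) g) \<longlonglongrightarrow> 0)"

definition factor :: "real \<Rightarrow> complex \<Rightarrow> nat \<Rightarrow> real \<Rightarrow> cmat2" where
  "factor a b m t = (\<chi> i k.
     if i = 1 \<and> k = 1 then complex_of_real a
     else if i = 1 \<and> k = 2 then b * exp (2 * pi * \<i> * of_nat m * of_real t)
     else if i = 2 \<and> k = 1 then cnj b * exp (- (2 * pi * \<i> * of_nat m * of_real t))
     else complex_of_real a)"

fun partial_prod :: "(nat \<Rightarrow> nat) \<Rightarrow> (nat \<Rightarrow> real) \<Rightarrow> (nat \<Rightarrow> complex) \<Rightarrow> nat \<Rightarrow> real \<Rightarrow> cmat2" where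
  "partial_prod m A B 0 t = mat 1"
| "partial_prod m A B (Suc N) t = partial_prod m A B N t ** factor (A (Suc N)) (B (Suc N)) (m (Suc N)) t"

end

theory Submission
  imports Defs
begin

text \<open>Let \<open>a\<close>, \<open>b\<close> be the entries of the first row of \<open>g\<^sub>N\<close>. Since the ratio is at least 2, the frequencies
  of \<open>a\<close> lie in \<open>(- m\<^sub>N, 0]\<close> and those of \<open>b\<close> in \<open>(0, m\<^sub>N]\<close>, so that the cross terms in the recursion for
  \<open>u = |a|\<^sup>2 + |b|\<^sup>2\<close> have mean zero. Hence \<open>u\<close> has mean \<open>P = \<Prod>(A\<^sub>j\<^sup>2 + |B\<^sub>j|\<^sup>2)\<close> and \<open>a\<close> has mean \<open>\<Prod>A\<^sub>j \<ge> 1\<close>,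
  which gives a squared \<open>L\<^sup>2\<close> distance of at most \<open>P - 1\<close> (up to a constant) from the identity. Applied to the
  blocks \<open>g\<^sub>n\<^sup>-\<^sup>1 g\<^sub>N\<close>, which are products of the same kind, this yields convergence for \<open>\<ell>\<^sup>2\<close> coefficients.

  Conversely, if the coefficients are not in \<open>\<ell>\<^sup>2\<close>, there are arbitrarily late blocks with \<open>\<Sum>|B\<^sub>j|\<^sup>2\<close> between 1
  and 2. On such a block \<open>|b|\<^sup>2\<close> has mean at least 1 and \<open>u\<^sup>2\<close> has bounded mean, so the block stays away from the
  identity on a set of measure bounded below, which contradicts convergence for every \<open>p > 0\<close>.\<close>

subsection \<open>Trigonometric polynomials on the circle\<close>

abbreviation circle :: "real measure" where
  "circle \<equiv> lebesgue_on {0..<1}"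

lemma continuous_imp_integrable_circle:
  fixes f :: "real \<Rightarrow> 'b::euclidean_space"
  assumes "continuous_on UNIV f"
  shows "integrable circle f"
proof -
  have "integrable (lebesgue_on {0..1}) f"
    by (rule continuous_imp_integrable_real) (rule continuous_on_subset[OF assms], simp)
  then have "set_integrable lebesgue {0..1} f"
    by (simp add: set_integrable_def integrable_restrict_space)
  then have "set_integrable lebesgue {0..<1} f"
    by (rule set_integrable_subset) auto
  then show ?thesis
    by (simp add: set_integrable_def integrable_restrict_space)
qed

lemma continuous_imp_measurable_circle:
  fixes f :: "real \<Rightarrow> 'b::topological_space"
  assumes "continuous_on UNIV f"
  shows "f \<in> borel_measurable circle"
  by (rule continuous_imp_measurable_on_sets_lebesgue[OF continuous_on_subset[OF assms]]) auto

lemma integral_Re_circle: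
  assumes "continuous_on UNIV f"
  shows "(LINT t|circle. Re (f t)) = Re (LINT t|circle. f t)"
  by (rule integral_Re) (rule continuous_imp_integrable_circle[OF assms])

lemma emeasure_circle [simp]: "emeasure circle {0..<1} = 1"
  by (simp add: emeasure_restrict_space)

lemma measure_circle [simp]: "measure circle {0..<1} = 1"
  by (simp add: measure_def)

section \<open>Characters and frequency ranges\<close>

definition character :: "int \<Rightarrow> real \<Rightarrow> complex" where
  "character k t = cis (2 * pi * of_int k * t)"

lemma character_0 [simp]: "character 0 t = 1"
  by (simp add: character_def)

lemma character_mult: "character j t * character k t = character (j + k) t"
  by (simp add: character_def cis_mult algebra_simps)

lemma cnj_character: "cnj (character k t) = character (- k) t"
  by (simp add: character_def cis_cnj)

lemma norm_character [simp]: "norm (character k t) = 1"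
  by (simp add: character_def)

lemma continuous_character [continuous_intros]: "continuous_on S (character k)"
  unfolding character_def [abs_def] cis_conv_exp by (intro continuous_intros)

lemma integral_character:
  assumes "k \<noteq> 0"
  shows "(LINT t|circle. character k t) = 0"
proof -
  define w where "w = 2 * pi * \<i> * of_int k"
  have w0: "w \<noteq> 0" using assms by (simp add: w_def)
  have eq: "character k = (\<lambda>t. exp (w * of_real t))"
    by (simp add: fun_eq_iff character_def cis_conv_exp w_def algebra_simps)
  have "((\<lambda>t. exp (w * of_real t)) has_integral (exp (w * of_real 1) / w - exp (w * of_real 0) / w)) {0..1::real}"
  proof (rule fundamental_theorem_of_calculus)
    fix x :: real assume "x \<in> {0..1}"
    show "((\<lambda>t. exp (w * complex_of_real t) / w) has_vector_derivative exp (w * of_real x)) (at x within {0..1})"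
      by (rule has_vector_derivative_real_field) (use w0 in \<open>auto intro!: derivative_eq_intros\<close>)
  qed simp
  moreover have "exp w = 1"
    using exp_integer_2pi[of "of_int k"] by (simp add: w_def algebra_simps)
  ultimately have "(character k has_integral 0) {0..1::real}"
    by (simp add: eq)
  \<comment> \<open>The fundamental theorem of calculus gives the integral over the closed interval;
    dropping the endpoint 1 removes a null set.\<close>
  moreover have "negligible {t \<in> {0..1} - {0..<1}. character k t \<noteq> 0}"
    by (rule negligible_subset[of "{1}"]) auto
  moreover have "{t \<in> {0..<1} - {0..1}. character k t \<noteq> 0} = {}"
    by auto
  ultimately have "(character k has_integral 0) {0..<1::real}"
    using has_integral_spike_set_eq[of "{0..1}" "{0..<1}" "character k" 0] by (simp only: negligible_empty)
  moreover have "integrable circle (character k)"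
    by (intro continuous_imp_integrable_circle continuous_intros)
  ultimately show ?thesis
    by (simp add: lebesgue_integral_eq_integral integral_unique)
qed

text \<open>Only an interval containing the frequencies is tracked, not the coefficients. That is
  enough: intervals add under multiplication, and an interval that misses 0 forces mean
  zero.\<close>

inductive trigpoly :: "int \<Rightarrow> int \<Rightarrow> (real \<Rightarrow> complex) \<Rightarrow> bool" for lo hi where
  zero: "trigpoly lo hi (\<lambda>t. 0)"
| add_term: "\<lbrakk>trigpoly lo hi f; lo \<le> k; k \<le> hi\<rbrakk> \<Longrightarrow> trigpoly lo hi (\<lambda>t. f t + x * character k t)"

lemma trigpoly_monomial: "lo \<le> k \<Longrightarrow> k \<le> hi \<Longrightarrow> trigpoly lo hi (\<lambda>t. x * character k t)"
  using trigpoly.add_term[OF trigpoly.zero, of lo k hi x] by simp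

lemma trigpoly_character: "trigpoly k k (character k)"
  using trigpoly_monomial[of k k k 1] by simp

lemma trigpoly_const: "trigpoly 0 0 (\<lambda>t. x)"
  using trigpoly_monomial[of 0 0 0 x] by simp

lemma trigpoly_mono: "trigpoly lo hi f \<Longrightarrow> lo' \<le> lo \<Longrightarrow> hi \<le> hi' \<Longrightarrow> trigpoly lo' hi' f"
  by (induction rule: trigpoly.induct) (auto intro: trigpoly.intros)

lemma trigpoly_add: "trigpoly lo hi g \<Longrightarrow> trigpoly lo hi f \<Longrightarrow> trigpoly lo hi (\<lambda>t. f t + g t)"
  by (induction rule: trigpoly.induct) (auto simp: add.assoc[symmetric] intro: trigpoly.add_term)

lemma trigpoly_monomial_mult:
  "trigpoly lo hi f \<Longrightarrow> trigpoly (lo + k) (hi + k) (\<lambda>t. f t * (x * character k t))"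
proof (induction rule: trigpoly.induct)
  case zero
  show ?case by (simp add: trigpoly.zero)
next
  case (add_term f j y)
  have "trigpoly (lo + k) (hi + k) (\<lambda>t. f t * (x * character k t) + (x * y) * character (j + k) t)"
    using add_term by (intro trigpoly.add_term) auto
  then show ?case
    by (simp add: algebra_simps character_mult[symmetric])
qed

lemma trigpoly_mult:
  assumes "trigpoly lo hi f" "trigpoly lo' hi' g"
  shows "trigpoly (lo + lo') (hi + hi') (\<lambda>t. f t * g t)"
  using assms(2)
proof (induction rule: trigpoly.induct)
  case zero
  show ?case by (simp add: trigpoly.zero)
next
  case (add_term g k x)
  have "trigpoly (lo + lo') (hi + hi') (\<lambda>t. f t * (x * character k t))"
    by (rule trigpoly_mono[OF trigpoly_monomial_mult[OF assms(1)]]) (use add_term in auto)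
  from trigpoly_add[OF this add_term.IH] show ?case
    by (simp add: algebra_simps)
qed

lemma trigpoly_cnj: "trigpoly lo hi f \<Longrightarrow> trigpoly (- hi) (- lo) (\<lambda>t. cnj (f t))"
  by (induction rule: trigpoly.induct) (auto simp: cnj_character intro!: trigpoly.intros)

lemma continuous_trigpoly: "trigpoly lo hi f \<Longrightarrow> continuous_on UNIV f"
  by (induction rule: trigpoly.induct) (auto intro!: continuous_intros)

text \<open>Orthogonality is used in this form only: cross terms are discarded because all their
  frequencies lie strictly on one side of 0.\<close>

lemma integral_trigpoly_eq_0:
  assumes "trigpoly lo hi f" "0 < lo \<or> hi < 0"
  shows "(LINT t|circle. f t) = 0"
  using assms(1)
proof (induction rule: trigpoly.induct)
  case zero
  show ?case by simp
next
  case (add_term f k x)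
  have "(LINT t|circle. f t + x * character k t) = (LINT t|circle. f t) + (LINT t|circle. x * character k t)"
    by (intro Bochner_Integration.integral_add continuous_imp_integrable_circle continuous_intros
        continuous_trigpoly[OF add_term(1)])
  also have "\<dots> = 0"
    using add_term assms(2) integral_character[of k] by auto
  finally show ?case .
qed

subsection \<open>The group SU(1,1) and the operator norm\<close>

lemma mat2_eq_iff:
  fixes M N :: cmat2
  shows "M = N \<longleftrightarrow> M$1$1 = N$1$1 \<and> M$1$2 = N$1$2 \<and> M$2$1 = N$2$1 \<and> M$2$2 = N$2$2"
  by (auto simp: vec_eq_iff forall_2)

lemma mat2_mult_nth:
  fixes M N :: cmat2
  shows "(M ** N)$i$j = M$i$1 * N$1$j + M$i$2 * N$2$j"
  by (simp add: matrix_matrix_mult_def sum_2)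

lemma mat2_one_nth [simp]:
  "(mat 1 :: cmat2)$1$1 = 1" "(mat 1 :: cmat2)$2$2 = 1"
  "(mat 1 :: cmat2)$1$2 = 0" "(mat 1 :: cmat2)$2$1 = 0"
  by (simp_all add: mat_def)

text \<open>The inverse of a matrix of determinant 1. Its entries are linear in those of
  \<open>M\<close>, which makes the continuity of \<open>rho\<close> on the group visible; the
  choice in \<open>matrix_inv\<close> hides it.\<close>

definition adjugate2 :: "cmat2 \<Rightarrow> cmat2" where
  "adjugate2 M = (\<chi> i j. if i = 1 then (if j = 1 then M$2$2 else - (M$1$2))
                         else (if j = 1 then - (M$2$1) else M$1$1))"

lemma adjugate2_nth [simp]:
  "adjugate2 M$1$1 = M$2$2" "adjugate2 M$1$2 = - (M$1$2)"
  "adjugate2 M$2$1 = - (M$2$1)" "adjugate2 M$2$2 = M$1$1"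
  by (simp_all add: adjugate2_def)

lemma SU11_nth:
  assumes "G \<in> SU11"
  shows "G$2$1 = cnj (G$1$2)" "G$2$2 = cnj (G$1$1)"
    "(cmod (G$1$1))\<^sup>2 = 1 + (cmod (G$1$2))\<^sup>2"
  using assms by (auto simp: SU11_def)

lemma SU11_det:
  assumes "G \<in> SU11"
  shows "G$1$1 * cnj (G$1$1) = 1 + G$1$2 * cnj (G$1$2)"
  unfolding complex_norm_square[symmetric] SU11_nth(3)[OF assms] by simp

lemma SU11_iff:
  "G \<in> SU11 \<longleftrightarrow> G$2$1 = cnj (G$1$2) \<and> G$2$2 = cnj (G$1$1) \<and>
     G$1$1 * cnj (G$1$1) = 1 + G$1$2 * cnj (G$1$2)"
proof -
  have "(cmod x)\<^sup>2 - (cmod y)\<^sup>2 = 1 \<longleftrightarrow> x * cnj x = 1 + y * cnj y" for x y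
  proof -
    have "x * cnj x = 1 + y * cnj y \<longleftrightarrow> complex_of_real ((cmod x)\<^sup>2) = of_real (1 + (cmod y)\<^sup>2)"
      by (simp only: complex_norm_square of_real_add of_real_1)
    then show ?thesis
      by (simp only: of_real_eq_iff) auto
  qed
  then show ?thesis
    by (simp add: SU11_def)
qed

lemma one_in_SU11 [simp]: "mat 1 \<in> SU11"
  by (simp add: SU11_def)

lemma SU11_mult:
  assumes "G \<in> SU11" "H \<in> SU11"
  shows "G ** H \<in> SU11"
proof -
  have det: "(a * c + b * cnj d) * (cnj a * cnj c + cnj b * d) = 1 + (a * d + b * cnj c) * (cnj a * cnj d + cnj b * c)"
    if "a * cnj a = 1 + b * cnj b" "c * cnj c = 1 + d * cnj d" for a b c d :: complex
  proof -
    \<comment> \<open>Multiplicativity of the determinant, written out for matrices of this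
      shape.\<close>
    have "(a * c + b * cnj d) * (cnj a * cnj c + cnj b * d) - (a * d + b * cnj c) * (cnj a * cnj d + cnj b * c)
        = (a * cnj a - b * cnj b) * (c * cnj c - d * cnj d)"
      by (simp add: algebra_simps)
    also have "\<dots> = 1"
      using that by simp
    finally show ?thesis
      by (simp add: algebra_simps)
  qed
  show ?thesis
    using assms det[of "G$1$1" "G$1$2" "H$1$1" "H$1$2"] unfolding SU11_iff mat2_mult_nth
    by (simp add: mult.commute add.commute)
qed

lemma adjugate2_in_SU11:
  assumes "G \<in> SU11"
  shows "adjugate2 G \<in> SU11"
  using assms unfolding SU11_iff by (simp add: mult.commute)

lemma adjugate2_inverse:
  assumes "G \<in> SU11"
  shows "adjugate2 G ** G = mat 1" "G ** adjugate2 G = mat 1"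
  using SU11_nth(1,2)[OF assms] SU11_det[OF assms] unfolding mat2_eq_iff mat2_mult_nth
  by (simp_all add: mult.commute)

lemma matrix_inv_SU11:
  assumes "G \<in> SU11"
  shows "matrix_inv G = adjugate2 G"
proof -
  have "G ** matrix_inv G = mat 1 \<and> matrix_inv G ** G = mat 1"
    unfolding matrix_inv_def by (rule someI[of _ "adjugate2 G"]) (simp add: adjugate2_inverse[OF assms])
  then show ?thesis
    by (metis adjugate2_inverse(1)[OF assms] matrix_mul_assoc matrix_mul_lid matrix_mul_rid)
qed

section \<open>Operator norm of 2 by 2 matrices\<close>

lemma opnorm_nonneg: "0 \<le> opnorm M"
  unfolding opnorm_def by (rule onorm_pos_le) simp

lemma norm_entry_le_opnorm: "cmod (M$i$j) \<le> opnorm M"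
proof -
  have "norm (axis j 1 :: complex^2) = 1"
    by (simp add: norm_vec_def L2_set_def axis_def if_distrib[of norm] if_distrib[of "\<lambda>x. x\<^sup>2"] cong: if_cong)
  moreover have "(M *v axis j 1)$i = M$i$j"
    by (cases "j = 1") (use exhaust_2[of j] in \<open>simp_all add: matrix_vector_mult_def axis_def sum_2\<close>)
  moreover have "cmod ((M *v axis j 1)$i) \<le> norm (M *v axis j 1)"
    by (rule Finite_Cartesian_Product.norm_nth_le)
  moreover have "norm (M *v axis j 1) \<le> opnorm M * norm (axis j 1 :: complex^2)"
    unfolding opnorm_def by (rule onorm) simp
  ultimately show ?thesis
    by simp
qed

lemma norm_vec2_le: "norm (x::'a::real_normed_vector^2) \<le> norm (x$1) + norm (x$2)"
  using L2_set_le_sum[of UNIV "\<lambda>i. norm (x$i)"] by (simp add: norm_vec_def sum_2)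

lemma norm_mat2_le: 
  "norm (M::cmat2) \<le> cmod (M$1$1) + cmod (M$1$2) + cmod (M$2$1) + cmod (M$2$2)"
  using norm_vec2_le[of M] norm_vec2_le[of "M$1"] norm_vec2_le[of "M$2"] by linarith

lemma opnorm_le:
  "opnorm M \<le> cmod (M$1$1) + cmod (M$1$2) + cmod (M$2$1) + cmod (M$2$2)" (is "_ \<le> ?S")
  unfolding opnorm_def
proof (rule onorm_bound)
  fix x :: "complex^2"
  have x: "cmod (x$i) \<le> norm x" for i by (rule Finite_Cartesian_Product.norm_nth_le)
  have row: "cmod ((M *v x)$i) \<le> (cmod (M$i$1) + cmod (M$i$2)) * norm x" for i
  proof -
    have "cmod ((M *v x)$i) \<le> cmod (M$i$1) * cmod (x$1) + cmod (M$i$2) * cmod (x$2)"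
      using norm_triangle_ineq[of "M$i$1 * x$1" "M$i$2 * x$2"]
      by (simp add: matrix_vector_mult_def sum_2 norm_mult)
    also have "\<dots> \<le> cmod (M$i$1) * norm x + cmod (M$i$2) * norm x"
      by (intro add_mono mult_left_mono x) auto
    finally show ?thesis by (simp add: distrib_right)
  qed
  show "norm (M *v x) \<le> ?S * norm x"
    using norm_vec2_le[of "M *v x"] row[of 1] row[of 2] unfolding distrib_right by linarith
qed simp

lemma opnorm_triangle: "opnorm (M + N) \<le> opnorm M + opnorm N"
proof -
  have "opnorm (M + N) = onorm (\<lambda>x. M *v x + N *v x)"
    by (simp add: opnorm_def matrix_vector_mult_add_rdistrib)
  also have "\<dots> \<le> opnorm M + opnorm N"
    unfolding opnorm_def by (rule onorm_triangle) simp_all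
  finally show ?thesis .
qed

lemma continuous_opnorm: "continuous_on S opnorm"
proof -
  have le: "opnorm M \<le> 4 * norm M" for M
  proof -
    have "cmod (M$i$j) \<le> norm M" for i j
      using Finite_Cartesian_Product.norm_nth_le[of M i] Finite_Cartesian_Product.norm_nth_le[of "M$i" j] by linarith
    from this[of 1 1] this[of 1 2] this[of 2 1] this[of 2 2] show ?thesis
      using opnorm_le[of M] by linarith
  qed
  have "\<bar>opnorm M - opnorm N\<bar> \<le> 4 * norm (M - N)" for M N
    using opnorm_triangle[of "M - N" N] opnorm_triangle[of "N - M" M] le[of "M - N"] le[of "N - M"]
    by (simp add: norm_minus_commute)
  then have "4-lipschitz_on S opnorm"
    by (intro lipschitz_onI) (auto simp: dist_norm)
  then show ?thesis
    by (rule lipschitz_on_continuous_on)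
qed

text \<open>The second row of \<open>G - mat 1\<close> repeats the moduli of the first, so
  \<open>opnorm_le\<close> gives \<open>2 * (x + y)\<close>, whose square is at most
  \<open>8 * (x^2 + y^2)\<close>. This turns mean square bounds on the first row into bounds on
  \<open>rho\<close>.\<close>

lemma opnorm_minus_one_le:
  assumes "G \<in> SU11"
  shows "(opnorm (G - mat 1))\<^sup>2 \<le> 8 * ((cmod (G$1$1 - 1))\<^sup>2 + (cmod (G$1$2))\<^sup>2)"
proof -
  define x y where "x = cmod (G$1$1 - 1)" and "y = cmod (G$1$2)"
  have "cmod (cnj (G$1$1) - 1) = x"
    unfolding x_def by (metis complex_cnj_diff complex_cnj_one complex_mod_cnj)
  then have "opnorm (G - mat 1) \<le> 2 * x + 2 * y"
    using opnorm_le[of "G - mat 1"] SU11_nth[OF assms] by (simp add: x_def y_def)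
  then have "(opnorm (G - mat 1))\<^sup>2 \<le> (2 * x + 2 * y)\<^sup>2"
    by (intro power_mono opnorm_nonneg)
  also have "\<dots> \<le> 8 * (x\<^sup>2 + y\<^sup>2)"
    using sum_squares_bound[of x y] by (simp add: power2_eq_square algebra_simps)
  finally show ?thesis
    by (simp add: x_def y_def)
qed

section \<open>The metric on the group\<close>

lemma rho_SU11:
  "G \<in> SU11 \<Longrightarrow> rho G H = ln (1 + opnorm (adjugate2 G ** H - mat 1))"
  by (simp add: rho_def matrix_inv_SU11)

text \<open>Left invariance: the distance between two partial products depends only on the block of
  factors between them.\<close>

lemma rho_mult:
  assumes "G \<in> SU11"
  shows "rho G (G ** H) = ln (1 + opnorm (H - mat 1))"
  by (simp add: rho_SU11[OF assms] matrix_mul_assoc adjugate2_inverse[OF assms])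

lemma rho_nonneg: "0 \<le> rho G H"
  by (simp add: rho_def opnorm_nonneg)

lemma continuous_mat2:
  fixes f :: "'a::topological_space \<Rightarrow> cmat2"
  assumes "continuous_on S (\<lambda>x. f x$1$1)" "continuous_on S (\<lambda>x. f x$1$2)"
    "continuous_on S (\<lambda>x. f x$2$1)" "continuous_on S (\<lambda>x. f x$2$2)"
  shows "continuous_on S f"
proof -
  have "continuous_on S (\<lambda>x. \<chi> i j. f x$i$j)"
  proof (intro continuous_on_vec_lambda)
    fix i j :: 2
    show "continuous_on S (\<lambda>x. f x$i$j)"
      using assms exhaust_2[of i] exhaust_2[of j] by auto
  qed
  then show ?thesis by simp
qed

text \<open>The formula agrees with \<open>rho\<close> when the first matrix lies in the group, but
  is continuous on all pairs of matrices. Measurability of \<open>rho\<close> and its limits then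
  follow by composition.\<close>

lemma continuous_rho_formula:
  "continuous_on UNIV (\<lambda>x. ln (1 + opnorm (adjugate2 (fst x) ** snd x - mat 1)))"
proof -
  have "continuous_on UNIV (\<lambda>x. adjugate2 (fst x) ** snd x - (mat 1 :: cmat2))"
    by (rule continuous_mat2) (auto simp: mat2_mult_nth intro!: continuous_intros)
  then have "continuous_on UNIV (\<lambda>x. opnorm (adjugate2 (fst x) ** snd x - mat 1))"
    by (rule continuous_on_compose2[OF continuous_opnorm[of UNIV]]) auto
  moreover have "1 + opnorm M \<noteq> 0" for M
    using opnorm_nonneg[of M] by linarith
  ultimately show ?thesis
    by (intro continuous_intros) auto
qed

lemma rho_measurable:
  assumes "f \<in> borel_measurable circle" "g \<in> borel_measurable circle"
    and "\<And>t. t \<in> {0..<1} \<Longrightarrow> f t \<in> SU11"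
  shows "(\<lambda>t. rho (f t) (g t)) \<in> borel_measurable circle"
proof -
  have "(\<lambda>t. ln (1 + opnorm (adjugate2 (f t) ** g t - mat 1))) \<in> borel_measurable circle"
    by (rule borel_measurable_continuous_Pair[OF assms(1,2) continuous_rho_formula])
  then show ?thesis
    by (rule measurable_cong[THEN iffD1, rotated]) (simp add: assms(3) rho_SU11)
qed

lemma tendsto_rho:
  assumes "G \<in> SU11" "(H \<longlongrightarrow> K) F"
  shows "((\<lambda>k. rho G (H k)) \<longlongrightarrow> rho G K) F"
proof -
  have "((\<lambda>k. (G, H k)) \<longlongrightarrow> (G, K)) F"
    by (intro tendsto_intros assms)
  from continuous_on_tendsto_compose[OF continuous_rho_formula this] show ?thesis
    by (simp add: rho_SU11[OF assms(1)])
qed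

text \<open>Keeps pointwise limits of partial products in the group.\<close>

lemma closed_SU11: "closed SU11"
  unfolding SU11_def
  by (intro closed_Collect_conj closed_Collect_eq continuous_intros)

text \<open>With \<open>X = G\<^sup>-\<^sup>1 K\<close> and \<open>Y = (G H)\<^sup>-\<^sup>1 K\<close> one has \<open>H = X Y\<^sup>-\<^sup>1\<close>.\<close>

lemma offdiag_le_of_rho_le:
  assumes SU: "G \<in> SU11" "H \<in> SU11" "K \<in> SU11" and "0 \<le> \<eta>"
    and 1: "rho G K \<le> ln (1 + \<eta>)" and 2: "rho (G ** H) K \<le> ln (1 + \<eta>)"
  shows "cmod (H$1$2) \<le> 2 * \<eta> * (1 + \<eta>)"
proof -
  define X where "X = adjugate2 G ** K"
  define Y where "Y = adjugate2 (G ** H) ** K"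
  have GH: "G ** H \<in> SU11" by (intro SU11_mult SU)
  have XY: "X \<in> SU11" "Y \<in> SU11"
    unfolding X_def Y_def by (intro SU11_mult adjugate2_in_SU11 SU GH)+
  have "G ** H ** Y = K"
    unfolding Y_def by (simp add: matrix_mul_assoc adjugate2_inverse[OF GH])
  then have "X = adjugate2 G ** (G ** H ** Y)"
    by (simp add: X_def)
  also have "\<dots> = H ** Y"
    by (simp add: matrix_mul_assoc adjugate2_inverse[OF SU(1)])
  finally have "H = X ** adjugate2 Y"
    by (simp add: matrix_mul_assoc[symmetric] adjugate2_inverse[OF XY(2)])
  then have H12: "H$1$2 = X$1$2 * Y$1$1 - X$1$1 * Y$1$2"
    by (simp add: mat2_mult_nth)
  have X: "opnorm (X - mat 1) \<le> \<eta>" and Y: "opnorm (Y - mat 1) \<le> \<eta>"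
    using 1 2 \<open>0 \<le> \<eta>\<close> opnorm_nonneg[of "X - mat 1"] opnorm_nonneg[of "Y - mat 1"]
    by (simp_all add: rho_SU11[OF SU(1)] rho_SU11[OF GH] X_def Y_def)
  have X12: "cmod (X$1$2) \<le> \<eta>" and Y12: "cmod (Y$1$2) \<le> \<eta>"
    using norm_entry_le_opnorm[of "X - mat 1" 1 2] norm_entry_le_opnorm[of "Y - mat 1" 1 2] X Y by auto
  have "cmod (X$1$1 - 1) \<le> \<eta>" "cmod (Y$1$1 - 1) \<le> \<eta>"
    using norm_entry_le_opnorm[of "X - mat 1" 1 1] norm_entry_le_opnorm[of "Y - mat 1" 1 1] X Y by auto
  then have X11: "cmod (X$1$1) \<le> 1 + \<eta>" and Y11: "cmod (Y$1$1) \<le> 1 + \<eta>"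
    using norm_triangle_ineq[of "X$1$1 - 1" 1] norm_triangle_ineq[of "Y$1$1 - 1" 1] by auto
  have "cmod (H$1$2) \<le> cmod (X$1$2) * cmod (Y$1$1) + cmod (X$1$1) * cmod (Y$1$2)"
    unfolding H12 norm_mult[symmetric] by (rule norm_triangle_ineq4)
  also have "\<dots> \<le> \<eta> * (1 + \<eta>) + (1 + \<eta>) * \<eta>"
    using \<open>0 \<le> \<eta>\<close> by (intro add_mono mult_mono X12 X11 Y12 Y11) auto
  finally show ?thesis by (simp add: algebra_simps)
qed

subsection \<open>Moments of lacunary products\<close>

lemma factor_nth [simp]:
  "factor x y k t $1$1 = of_real x" "factor x y k t $1$2 = y * character (int k) t"
  "factor x y k t $2$1 = cnj y * character (- int k) t" "factor x y k t $2$2 = of_real x"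
  by (simp_all add: factor_def character_def cis_conv_exp algebra_simps)

text \<open>The hypotheses of the theorem with the ratio lowered to 2. They concern indices from 1
  on, so the class is stable under dropping the first \<open>n\<close> factors; \<open>shift\<close>
  exploits this to apply every moment bound to blocks.\<close>

locale lacunary_product =
  fixes m :: "nat \<Rightarrow> nat" and A :: "nat \<Rightarrow> real" and B :: "nat \<Rightarrow> complex"
  assumes m_pos: "1 \<le> j \<Longrightarrow> 0 < m j"
    and m_double: "1 \<le> j \<Longrightarrow> 2 * m j \<le> m (Suc j)"
    and A_pos: "1 \<le> j \<Longrightarrow> 0 < A j"
    and A_sq: "1 \<le> j \<Longrightarrow> (A j)\<^sup>2 = 1 + (cmod (B j))\<^sup>2"
begin

definition a :: "nat \<Rightarrow> real \<Rightarrow> complex" where "a N t = partial_prod m A B N t $1$1"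
definition b :: "nat \<Rightarrow> real \<Rightarrow> complex" where "b N t = partial_prod m A B N t $1$2"
text \<open>With the adjoint of \<open>g_N\<close> multiplied on its right by \<open>g_N\<close>,
  \<open>u\<close> is the diagonal entry and \<open>c\<close> the lower left entry. A new factor
  sandwiches this product between itself and its adjoint, so \<open>u\<close> and \<open>c\<close>
  satisfy a recursion of their own. \<open>s j\<close> is the value of \<open>u\<close> for the
  single factor \<open>j\<close>.\<close>

definition u :: "nat \<Rightarrow> real \<Rightarrow> real" where "u N t = (cmod (a N t))\<^sup>2 + (cmod (b N t))\<^sup>2"
definition c :: "nat \<Rightarrow> real \<Rightarrow> complex" where "c N t = 2 * a N t * cnj (b N t)"
definition s :: "nat \<Rightarrow> real" where "s j = (A j)\<^sup>2 + (cmod (B j))\<^sup>2"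

text \<open>\<open>m 0\<close> is unconstrained. The value 1 at \<open>N = 0\<close> makes the
  ranges in \<open>trigpoly_ab\<close> correct for the empty product and keeps \<open>deg N\<close>
  at most \<open>m (Suc N)\<close>.\<close>

definition deg :: "nat \<Rightarrow> int" where "deg N = (if N = 0 then 1 else int (m N))"

lemma factor_in_SU11: "1 \<le> j \<Longrightarrow> factor (A j) (B j) (m j) t \<in> SU11"
  by (simp add: SU11_def A_sq cnj_character norm_mult)

lemma partial_prod_in_SU11: "partial_prod m A B N t \<in> SU11"
  by (induction N) (auto intro!: SU11_mult factor_in_SU11)

lemma a_0 [simp]: "a 0 t = 1" and b_0 [simp]: "b 0 t = 0"
  by (simp_all add: a_def b_def)

lemma a_Suc: "a (Suc N) t =
    a N t * of_real (A (Suc N)) + b N t * (cnj (B (Suc N)) * character (- int (m (Suc N))) t)"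
  and b_Suc: "b (Suc N) t =
    a N t * (B (Suc N) * character (int (m (Suc N))) t) + b N t * of_real (A (Suc N))"
  by (simp_all add: a_def b_def mat2_mult_nth)

lemma norm_a_sq: "(cmod (a N t))\<^sup>2 = 1 + (cmod (b N t))\<^sup>2"
  unfolding a_def b_def by (rule SU11_nth(3)[OF partial_prod_in_SU11])

lemma u_ge_1: "1 \<le> u N t"
  by (simp add: u_def norm_a_sq)

lemma norm_c_le: "cmod (c N t) \<le> u N t"
  using sum_squares_bound[of "cmod (a N t)" "cmod (b N t)"]
  by (simp add: c_def u_def norm_mult)

lemma u_0 [simp]: "u 0 t = 1" and c_0 [simp]: "c 0 t = 0"
  by (simp_all add: u_def c_def)

lemma u_conv: "complex_of_real (u N t) = a N t * cnj (a N t) + b N t * cnj (b N t)"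
  by (simp only: u_def of_real_add complex_norm_square)

lemma u_Suc: "u (Suc N) t = s (Suc N) * u N t +
    Re (2 * of_real (A (Suc N)) * B (Suc N) * character (int (m (Suc N))) t * c N t)"
proof -
  define x y e where "x = A (Suc N)" and "y = B (Suc N)" and "e = character (int (m (Suc N))) t"
  have e: "e * cnj e = 1" "character (- int (m (Suc N))) t = cnj e"
    by (simp_all add: e_def cnj_character character_mult)
  have s: "complex_of_real (s (Suc N)) = of_real x * of_real x + y * cnj y"
    unfolding s_def x_def y_def of_real_add complex_norm_square by (simp add: power2_eq_square)
  have re: "complex_of_real (Re z) = (z + cnj z) / 2" for z
    by (simp add: complex_eq_iff)
  \<comment> \<open>Both sides are polynomials in the entries and their conjugates; they agree by
    the relation \<open>e * cnj e = 1\<close>.\<close>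
  have "complex_of_real (u (Suc N) t) = of_real (s (Suc N)) * of_real (u N t)
      + of_real (Re (2 * of_real x * y * e * c N t))"
    unfolding u_conv a_Suc b_Suc s re c_def x_def[symmetric] y_def[symmetric] e_def[symmetric] e(2)
    using e(1) by (simp add: field_simps) algebra
  then show ?thesis
    unfolding x_def y_def e_def by (metis of_real_add of_real_eq_iff of_real_mult)
qed

lemma c_Suc: "c (Suc N) t = (of_real (A (Suc N)))\<^sup>2 * c N t
    + (cnj (B (Suc N)))\<^sup>2 * character (- 2 * int (m (Suc N))) t * cnj (c N t)
    + 2 * of_real (A (Suc N)) * cnj (B (Suc N)) * character (- int (m (Suc N))) t * of_real (u N t)"
proof -
  define e where "e = character (int (m (Suc N))) t"
  have e: "character (- int (m (Suc N))) t = cnj e" "character (- 2 * int (m (Suc N))) t = cnj e * cnj e"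
    by (simp_all add: e_def cnj_character character_mult)
  show ?thesis
    unfolding c_def a_Suc b_Suc u_conv e e_def[symmetric]
    by (simp add: algebra_simps power2_eq_square)
qed

section \<open>Frequency ranges of the entries and of \<open>u\<close> and \<open>c\<close>\<close>

lemma deg_ge_1: "1 \<le> deg N"
  using m_pos[of N] by (simp add: deg_def Suc_le_eq)

lemma deg_le: "deg N \<le> int (m (Suc N))"
  using m_pos[of "Suc N"] m_double[of N] by (auto simp: deg_def)

text \<open>At \<open>N = 0\<close> this would fail for \<open>m 1 = 1\<close>. Its uses treat that
  case separately, where \<open>b\<close> and \<open>c\<close> vanish.\<close>

lemma double_deg_le: "N \<noteq> 0 \<Longrightarrow> 2 * deg N \<le> int (m (Suc N))"
  using m_double[of N] by (auto simp: deg_def)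

text \<open>Write \<open>M\<close> for \<open>m (Suc N)\<close>. In the recursion the range of
  \<open>b N\<close> is shifted down by \<open>M\<close>, which lands in (-M, 0], and that of
  \<open>a N\<close> is shifted up by \<open>M\<close>, which lands in (0, M]. Both follow from
  \<open>deg N \<le> M\<close>.\<close>

lemma trigpoly_ab: "trigpoly (1 - deg N) 0 (a N) \<and> trigpoly 1 (deg N) (b N)"
proof (induction N)
  case 0
  have "a 0 = (\<lambda>t. 1)" "b 0 = (\<lambda>t. 0)"
    by (simp_all add: fun_eq_iff)
  then show ?case
    using trigpoly_const[of 1] trigpoly.zero[of 1 1] by (simp add: deg_def)
next
  case (Suc N)
  have ds: "deg (Suc N) = int (m (Suc N))" by (simp add: deg_def)
  have mono: "trigpoly (lo + k) (hi + k) (\<lambda>t. f t * (x * character k t))" if "trigpoly lo hi f" for lo hi k f x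
    using trigpoly_monomial_mult[OF that] .
  have cst: "trigpoly lo hi (\<lambda>t. f t * x)" if "trigpoly lo hi f" for lo hi f x
    using trigpoly_mult[OF that trigpoly_const] by simp
  have "trigpoly (1 - deg (Suc N)) 0 (a (Suc N))"
    unfolding a_Suc[abs_def]
    by (rule trigpoly_add; rule trigpoly_mono, (rule mono cst, rule Suc.IH[THEN conjunct1] Suc.IH[THEN conjunct2]))
      (use deg_le[of N] deg_ge_1[of N] in \<open>auto simp: ds\<close>)
  moreover have "trigpoly 1 (deg (Suc N)) (b (Suc N))"
    unfolding b_Suc[abs_def]
    by (rule trigpoly_add; rule trigpoly_mono, (rule mono cst, rule Suc.IH[THEN conjunct1] Suc.IH[THEN conjunct2]))
      (use deg_le[of N] deg_ge_1[of N] in \<open>auto simp: ds\<close>)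
  ultimately show ?case ..
qed

lemmas trigpoly_a = trigpoly_ab[THEN conjunct1]
lemmas trigpoly_b = trigpoly_ab[THEN conjunct2]

lemma trigpoly_c: "trigpoly (1 - 2 * deg N) (- 1) (c N)"
proof -
  have "trigpoly (1 - deg N + - deg N) (0 + - 1) (\<lambda>t. a N t * cnj (b N t))"
    by (rule trigpoly_mult[OF trigpoly_a trigpoly_cnj[OF trigpoly_b]])
  from trigpoly_mult[OF trigpoly_const[of 2] this] show ?thesis
    by (simp add: c_def[abs_def] mult.assoc algebra_simps)
qed

lemma trigpoly_u: "trigpoly (1 - deg N) (deg N - 1) (\<lambda>t. of_real (u N t))"
  unfolding u_conv
  by (rule trigpoly_add; rule trigpoly_mono, rule trigpoly_mult[OF _ trigpoly_cnj], rule trigpoly_a trigpoly_b,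
      rule trigpoly_a trigpoly_b)
    auto

lemma continuous_a [continuous_intros]: "continuous_on UNIV (a N)"
  and continuous_b [continuous_intros]: "continuous_on UNIV (b N)"
  using continuous_trigpoly trigpoly_ab by blast+

lemma continuous_u [continuous_intros]: "continuous_on UNIV (u N)"
  unfolding u_def[abs_def] by (intro continuous_intros)

lemma continuous_c [continuous_intros]: "continuous_on UNIV (c N)"
  unfolding c_def[abs_def] by (intro continuous_intros)

lemma continuous_partial_prod: "continuous_on UNIV (partial_prod m A B N)"
proof (rule continuous_mat2)
  have eq: "partial_prod m A B N t $1$1 = a N t" "partial_prod m A B N t $1$2 = b N t"
    "partial_prod m A B N t $2$1 = cnj (b N t)" "partial_prod m A B N t $2$2 = cnj (a N t)" for t
    by (simp_all add: a_def b_def SU11_nth[OF partial_prod_in_SU11])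
  show "continuous_on UNIV (\<lambda>x. partial_prod m A B N x $ 1 $ 1)" "continuous_on UNIV (\<lambda>x. partial_prod m A B N x $ 1 $ 2)"
    "continuous_on UNIV (\<lambda>x. partial_prod m A B N x $ 2 $ 1)" "continuous_on UNIV (\<lambda>x. partial_prod m A B N x $ 2 $ 2)"
    unfolding eq by (intro continuous_intros)+
qed

text \<open>Doubling enters here: the frequencies of \<open>c N\<close> exceed
  \<open>- 2 * deg N\<close>, which is at least \<open>- m (Suc N)\<close>, so multiplication by
  \<open>character k\<close> makes them all positive.\<close>

lemma integral_c_character:
  assumes "int (m (Suc N)) \<le> k"
  shows "(LINT t|circle. character k t * c N t) = 0"
proof (cases "N = 0")
  case False
  then have "0 < k + (1 - 2 * deg N)"
    using double_deg_le[of N] assms by simp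
  then show ?thesis
    by (intro integral_trigpoly_eq_0[OF trigpoly_mult[OF trigpoly_character trigpoly_c]]) auto
qed simp

section \<open>Means of \<open>u\<close>, of \<open>a\<close> and of the squared distance from the
  identity\<close>

lemma integral_u: "(LINT t|circle. u N t) = (\<Prod>j=1..N. s j)"
proof (induction N)
  case (Suc N)
  let ?w = "2 * of_real (A (Suc N)) * B (Suc N)" and ?e = "character (int (m (Suc N)))"
  have "(LINT t|circle. u (Suc N) t) =
      (LINT t|circle. s (Suc N) * u N t) + (LINT t|circle. Re (?w * (?e t * c N t)))"
    unfolding u_Suc mult.assoc
    by (intro Bochner_Integration.integral_add continuous_imp_integrable_circle continuous_intros)
  also have "(LINT t|circle. Re (?w * (?e t * c N t))) = Re (LINT t|circle. ?w * (?e t * c N t))"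
    by (intro integral_Re_circle continuous_intros)
  also have "\<dots> = 0"
    by (simp add: integral_c_character)
  finally show ?case
    by (simp add: Suc.IH mult.commute)
qed simp

text \<open>The recursion shifts the contribution of \<open>b N\<close> to strictly negative
  frequencies, so the mean is just multiplied by \<open>A (Suc N)\<close>.\<close>

lemma integral_a: "(LINT t|circle. a N t) = of_real (\<Prod>j=1..N. A j)"
proof (induction N)
  case (Suc N)
  have zero: "(LINT t|circle. b N t * (cnj (B (Suc N)) * character (- int (m (Suc N))) t)) = 0"
  proof (cases "N = 0")
    case False
    then have "deg N + - int (m (Suc N)) < 0"
      using double_deg_le[of N] deg_ge_1[of N] by simp
    then show ?thesis
      by (intro integral_trigpoly_eq_0[OF trigpoly_monomial_mult[OF trigpoly_b]]) auto
  qed simp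
  have "(LINT t|circle. a (Suc N) t) = (LINT t|circle. a N t * of_real (A (Suc N)))
      + (LINT t|circle. b N t * (cnj (B (Suc N)) * character (- int (m (Suc N))) t))"
    unfolding a_Suc
    by (intro Bochner_Integration.integral_add continuous_imp_integrable_circle continuous_intros)
  then show ?case
    by (simp add: Suc.IH zero)
qed simp

lemma A_ge_1: "1 \<le> j \<Longrightarrow> 1 \<le> A j"
  using A_pos[of j] A_sq[of j] by (intro power2_le_imp_le[of 1 "A j"]) auto

lemma s_eq: "1 \<le> j \<Longrightarrow> s j = 1 + 2 * (cmod (B j))\<^sup>2"
  by (simp add: s_def A_sq)

lemma integral_norm_b_sq: "(LINT t|circle. (cmod (b N t))\<^sup>2) = ((\<Prod>j=1..N. s j) - 1) / 2"
proof -
  have "(\<lambda>t. (cmod (b N t))\<^sup>2) = (\<lambda>t. (u N t - 1) / 2)"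
    by (simp add: u_def norm_a_sq)
  moreover have "(LINT t|circle. u N t - 1) = (LINT t|circle. u N t) - (LINT t|circle. (1::real))"
    by (intro Bochner_Integration.integral_diff continuous_imp_integrable_circle continuous_intros)
  ultimately show ?thesis
    by (simp add: integral_u)
qed

text \<open>The integrand is \<open>u + 1 - 2 * Re a\<close>, with integral
  \<open>P + 1 - 2 * Q\<close>, where \<open>P\<close> is the product of the \<open>s j\<close> and
  \<open>Q\<close> that of the \<open>A j\<close>. Now \<open>Q \<ge> 1\<close>.\<close>

lemma integral_distance_one:
  "(LINT t|circle. (cmod (a N t - 1))\<^sup>2 + (cmod (b N t))\<^sup>2) \<le> (\<Prod>j=1..N. s j) - 1"
proof -
  have eq: "(cmod (a N t - 1))\<^sup>2 + (cmod (b N t))\<^sup>2 = u N t + 1 - 2 * Re (a N t)" for t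
    unfolding u_def cmod_power2 by (simp add: power2_eq_square algebra_simps)
  have "(LINT t|circle. u N t + 1 - 2 * Re (a N t))
      = (LINT t|circle. u N t + 1) - (LINT t|circle. 2 * Re (a N t))"
    by (intro Bochner_Integration.integral_diff continuous_imp_integrable_circle continuous_intros)
  also have "(LINT t|circle. u N t + 1) = (LINT t|circle. u N t) + (LINT t|circle. (1::real))"
    by (intro Bochner_Integration.integral_add continuous_imp_integrable_circle continuous_intros)
  also have "(LINT t|circle. 2 * Re (a N t)) = 2 * (\<Prod>j=1..N. A j)"
    using integral_Re_circle[OF continuous_a[of N]] by (simp add: integral_a del: of_real_prod)
  finally have "(LINT t|circle. u N t + 1 - 2 * Re (a N t)) = (\<Prod>j=1..N. s j) + 1 - 2 * (\<Prod>j=1..N. A j)"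
    by (simp add: integral_u)
  moreover have "1 \<le> (\<Prod>j=1..N. A j)"
    by (rule prod_ge_1) (simp add: A_ge_1)
  ultimately show ?thesis
    by (simp add: eq)
qed

section \<open>Second moment of \<open>u\<close>, hence fourth moments of the entries\<close>

definition E :: "nat \<Rightarrow> real" where "E N = (LINT t|circle. (u N t)\<^sup>2)"

lemma E_nonneg: "0 \<le> E N"
  unfolding E_def by simp

lemma E_0: "E 0 = 1"
  by (simp add: E_def)

text \<open>\<open>A + |B|\<close> is the operator norm of the factor.\<close>

lemma u_Suc_le: "u (Suc N) t \<le> (A (Suc N) + cmod (B (Suc N)))\<^sup>2 * u N t"
proof -
  let ?w = "2 * of_real (A (Suc N)) * B (Suc N) * character (int (m (Suc N))) t * c N t"
  have "Re ?w \<le> cmod ?w" by (rule complex_Re_le_cmod)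
  also have "\<dots> = 2 * A (Suc N) * cmod (B (Suc N)) * cmod (c N t)"
    using A_pos[of "Suc N"] by (simp add: norm_mult)
  also have "\<dots> \<le> 2 * A (Suc N) * cmod (B (Suc N)) * u N t"
    using A_pos[of "Suc N"] by (intro mult_left_mono norm_c_le) auto
  finally show ?thesis
    unfolding u_Suc s_def by (simp add: power2_eq_square algebra_simps)
qed

lemma A_le:
  assumes "1 \<le> j" "cmod (B j) \<le> 1"
  shows "A j \<le> 3 / 2"
proof (rule power2_le_imp_le)
  have "(cmod (B j))\<^sup>2 \<le> 1" using assms(2) by (simp add: power_le_one)
  then show "(A j)\<^sup>2 \<le> (3 / 2)\<^sup>2" using A_sq[OF assms(1)] by (simp add: power2_eq_square)
qed simp

text \<open>For ratio 2 the product \<open>u c\<close> at level \<open>N\<close> may contain the frequency \<open>- m\<^sub>N\<^sub>+\<^sub>1\<close>. Expanded one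
  level back, its only term not controlled by \<open>|B\<^sub>N|\<close> has frequencies above \<open>- 3 m\<^sub>N\<^sub>-\<^sub>1\<close>.\<close>

lemma cross_term_le:
  assumes le1: "cmod (B (Suc N)) \<le> 1"
  shows "cmod (LINT t|circle. character (int (m (Suc (Suc N)))) t * (of_real (u (Suc N) t) * c (Suc N) t))
    \<le> 31 * cmod (B (Suc N)) * E N"
proof -
  define x y k where "x = A (Suc N)" and "y = B (Suc N)" and "k = int (m (Suc N))"
  define e where "e = character (int (m (Suc (Suc N))))"
  \<comment> \<open>Each term of \<open>R\<close> carries an explicit factor \<open>y\<close> or its
    conjugate; what is split off is a constant multiple of \<open>u N * c N\<close>.\<close>
  define R where "R t = of_real (s (Suc N) * u N t) * ((cnj y)\<^sup>2 * character (- 2 * k) t * cnj (c N t)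
      + 2 * of_real x * cnj y * character (- k) t * of_real (u N t))
      + of_real (Re (2 * of_real x * y * character k t * c N t)) * c (Suc N) t" for t
  have split: "of_real (u (Suc N) t) * c (Suc N) t
      = of_real (s (Suc N)) * (of_real x)\<^sup>2 * (of_real (u N t) * c N t) + R t" for t
  proof -
    have "of_real (u (Suc N) t) * c (Suc N) t = of_real (s (Suc N) * u N t) * c (Suc N) t
        + of_real (Re (2 * of_real x * y * character k t * c N t)) * c (Suc N) t"
      by (simp add: u_Suc x_def y_def k_def distrib_right)
    also have "of_real (s (Suc N) * u N t) * c (Suc N) t = of_real (s (Suc N) * u N t) *
       ((of_real x)\<^sup>2 * c N t + (cnj y)\<^sup>2 * character (- 2 * k) t * cnj (c N t)
         + 2 * of_real x * cnj y * character (- k) t * of_real (u N t))"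
      by (simp add: c_Suc x_def y_def k_def)
    finally show ?thesis
      by (simp add: R_def algebra_simps)
  qed
  have cont_e: "continuous_on UNIV e"
    unfolding e_def by (intro continuous_intros)
  have cont_uc: "continuous_on UNIV (\<lambda>t. of_real (u N t) * c N t)" for N
    by (intro continuous_intros)
  have cont_R: "continuous_on UNIV R"
    unfolding R_def[abs_def] by (intro continuous_intros)
  \<comment> \<open>For \<open>N \<noteq> 0\<close> the frequencies of \<open>u N * c N\<close> are
    at least \<open>2 - 3 * deg N\<close>, while doubling twice gives
    \<open>m (Suc (Suc N)) \<ge> 4 * deg N\<close>.\<close>
  have zero: "(LINT t|circle. e t * (of_real (u N t) * c N t)) = 0"
  proof (cases "N = 0")
    case False
    then have "0 < int (m (Suc (Suc N))) + ((1 - deg N) + (1 - 2 * deg N))"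
      using double_deg_le[of N] double_deg_le[of "Suc N"] deg_ge_1[of N] by (simp add: deg_def[of "Suc N"])
    then show ?thesis
      unfolding e_def
      by (intro integral_trigpoly_eq_0[OF trigpoly_mult[OF trigpoly_character trigpoly_mult[OF trigpoly_u trigpoly_c]]])
        auto
  qed simp
  have "(LINT t|circle. e t * (of_real (u (Suc N) t) * c (Suc N) t))
      = (LINT t|circle. of_real (s (Suc N)) * (of_real x)\<^sup>2 * (e t * (of_real (u N t) * c N t)) + e t * R t)"
    unfolding split by (simp add: algebra_simps)
  also have "\<dots> = (LINT t|circle. of_real (s (Suc N)) * (of_real x)\<^sup>2 * (e t * (of_real (u N t) * c N t)))
      + (LINT t|circle. e t * R t)"
    by (intro Bochner_Integration.integral_add continuous_imp_integrable_circle continuous_intros cont_e cont_uc cont_R)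
  also have "\<dots> = (LINT t|circle. e t * R t)"
    by (simp add: zero)
  also have "cmod \<dots> \<le> (LINT t|circle. cmod (e t * R t))"
    by (rule integral_norm_bound)
  also have "\<dots> \<le> (LINT t|circle. 31 * cmod y * (u N t)\<^sup>2)"
  proof (rule integral_mono)
    show "integrable circle (\<lambda>t. cmod (e t * R t))" "integrable circle (\<lambda>t. 31 * cmod y * (u N t)\<^sup>2)"
      by (intro continuous_imp_integrable_circle continuous_intros cont_e cont_R)+
  next
    fix t
    have u: "1 \<le> u N t" by (rule u_ge_1)
    have y: "0 \<le> cmod y" "cmod y \<le> 1" using le1 by (simp_all add: y_def)
    have x: "0 < x" "x \<le> 3 / 2" using A_pos[of "Suc N"] A_le[of "Suc N"] le1 by (simp_all add: x_def)
    have y2: "(cmod y)\<^sup>2 \<le> cmod y" using y by (simp add: power2_eq_square mult_left_le)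
    have s: "0 \<le> s (Suc N)" "s (Suc N) \<le> 3" using y2 y s_eq[of "Suc N"] by (simp_all add: y_def)
    have "cmod ((cnj y)\<^sup>2 * character (- 2 * k) t * cnj (c N t)) \<le> cmod y * u N t"
      using y2 norm_c_le[of N t] y by (simp add: norm_mult norm_power mult_mono)
    moreover have "cmod (2 * of_real x * cnj y * character (- k) t * of_real (u N t)) \<le> 3 * cmod y * u N t"
      using x u y mult_right_mono[of "2 * x" 3 "cmod y * u N t"] by (simp add: norm_mult mult.assoc)
    ultimately have "cmod ((cnj y)\<^sup>2 * character (- 2 * k) t * cnj (c N t)
        + 2 * of_real x * cnj y * character (- k) t * of_real (u N t)) \<le> 4 * (cmod y * u N t)"
      by (intro order_trans[OF norm_triangle_ineq]) linarith
    moreover have "cmod (of_real (s (Suc N) * u N t)) \<le> 3 * u N t"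
      using s u by (simp add: norm_mult)
    ultimately have first: "cmod (of_real (s (Suc N) * u N t) * ((cnj y)\<^sup>2 * character (- 2 * k) t * cnj (c N t)
        + 2 * of_real x * cnj y * character (- k) t * of_real (u N t))) \<le> (3 * u N t) * (4 * (cmod y * u N t))"
      unfolding norm_mult[of "of_real _"] using u by (intro mult_mono) auto
    have "\<bar>Re (2 * of_real x * y * character k t * c N t)\<bar> \<le> cmod (2 * of_real x * y * character k t * c N t)"
      by (rule abs_Re_le_cmod)
    also have "\<dots> = 2 * x * (cmod y * cmod (c N t))"
      using x by (simp add: norm_mult)
    also have "\<dots> \<le> 3 * (cmod y * u N t)"
      using x y u norm_c_le[of N t] by (intro mult_mono) auto
    finally have re: "\<bar>Re (2 * of_real x * y * character k t * c N t)\<bar> \<le> 3 * (cmod y * u N t)" .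
    \<comment> \<open>The value 25/4 is then rounded up to 19/3, so that the final constant is the
      integer \<open>3 * 4 + 3 * (19 / 3) = 31\<close>.\<close>
    have "(x + cmod y)\<^sup>2 \<le> (5 / 2)\<^sup>2"
      using x y by (intro power_mono) auto
    then have "(x + cmod y)\<^sup>2 * u N t \<le> 19 / 3 * u N t"
      using u by (intro mult_right_mono) (auto simp: power2_eq_square)
    then have "cmod (c (Suc N) t) \<le> 19 / 3 * u N t"
      using norm_c_le[of "Suc N" t] u_Suc_le[of N t] by (simp add: x_def y_def)
    with re have second: "cmod (of_real (Re (2 * of_real x * y * character k t * c N t)) * c (Suc N) t)
        \<le> (3 * (cmod y * u N t)) * (19 / 3 * u N t)"
      unfolding norm_mult[of "of_real _"] norm_of_real using u y by (intro mult_mono) auto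
    have "cmod (R t) \<le> (3 * u N t) * (4 * (cmod y * u N t)) + (3 * (cmod y * u N t)) * (19 / 3 * u N t)"
      unfolding R_def by (intro order_trans[OF norm_triangle_ineq] add_mono first second)
    also have "\<dots> = 31 * cmod y * (u N t)\<^sup>2"
      by (simp add: power2_eq_square)
    finally show "cmod (e t * R t) \<le> 31 * cmod y * (u N t)\<^sup>2"
      by (simp add: e_def norm_mult)
  qed
  finally show ?thesis
    by (simp add: e_def y_def E_def)
qed


text \<open>On squaring \<open>u_Suc\<close> the two squares contribute at most
  \<open>1 + 8 * z + 8 * z^2 \<le> 1 + 16 * z\<close> with \<open>z = |B|^2\<close>, and the mixed
  term has coefficient \<open>4 * s * A * |B|\<close>, at most \<open>4 * 3 * (3 / 2) * |B|\<close>.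
  This is only linear in \<open>|B|\<close>; the second small factor comes from
  \<open>cross_term_le\<close>.\<close>

lemma E_Suc_le:
  assumes "cmod (B (Suc N)) \<le> 1"
  shows "E (Suc N) \<le> (1 + 16 * (cmod (B (Suc N)))\<^sup>2) * E N
    + 18 * cmod (B (Suc N)) * cmod (LINT t|circle. character (int (m (Suc N))) t * (of_real (u N t) * c N t))"
proof -
  define x y \<sigma> where "x = A (Suc N)" and "y = B (Suc N)" and "\<sigma> = s (Suc N)"
  define e where "e = character (int (m (Suc N)))"
  define W where "W = (LINT t|circle. e t * (of_real (u N t) * c N t))"
  have y: "0 \<le> cmod y" "cmod y \<le> 1" using assms by (simp_all add: y_def)
  have x: "0 < x" "x \<le> 3 / 2" using A_pos[of "Suc N"] A_le[of "Suc N"] assms by (simp_all add: x_def)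
  have x2: "x\<^sup>2 = 1 + (cmod y)\<^sup>2" using A_sq[of "Suc N"] by (simp add: x_def y_def)
  have y2: "(cmod y)\<^sup>2 \<le> 1" using y by (simp add: power_le_one)
  have \<sigma>_eq: "\<sigma> = 1 + 2 * (cmod y)\<^sup>2" using s_eq[of "Suc N"] by (simp add: \<sigma>_def y_def)
  then have \<sigma>: "0 \<le> \<sigma>" "\<sigma> \<le> 3" using y2 by auto
  have cont_e: "continuous_on UNIV e"
    unfolding e_def by (intro continuous_intros)
  have pointwise: "(u (Suc N) t)\<^sup>2 \<le> (1 + 16 * (cmod y)\<^sup>2) * (u N t)\<^sup>2
      + Re (4 * of_real (\<sigma> * x) * y * (e t * (of_real (u N t) * c N t)))" for t
  proof -
    define r where "r = Re (2 * of_real x * y * e t * c N t)"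
    have "\<bar>r\<bar> \<le> cmod (2 * of_real x * y * e t * c N t)"
      unfolding r_def by (rule abs_Re_le_cmod)
    also have "\<dots> = 2 * x * cmod y * cmod (c N t)"
      using x by (simp add: norm_mult e_def)
    also have "\<dots> \<le> 2 * x * cmod y * u N t"
      using x by (intro mult_left_mono norm_c_le) auto
    finally have "\<bar>r\<bar> \<le> 2 * x * cmod y * u N t" .
    then have "\<bar>r\<bar>\<^sup>2 \<le> (2 * x * cmod y * u N t)\<^sup>2"
      by (intro power_mono) auto
    then have r2: "r\<^sup>2 \<le> 4 * x\<^sup>2 * (cmod y)\<^sup>2 * (u N t)\<^sup>2"
      by (simp add: power_mult_distrib)
    have "\<sigma>\<^sup>2 + 4 * x\<^sup>2 * (cmod y)\<^sup>2 = 1 + 8 * (cmod y)\<^sup>2 + 8 * ((cmod y)\<^sup>2 * (cmod y)\<^sup>2)"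
      unfolding \<sigma>_eq x2 by (simp add: power2_eq_square algebra_simps)
    also have "\<dots> \<le> 1 + 16 * (cmod y)\<^sup>2"
      using mult_right_mono[OF y2, of "(cmod y)\<^sup>2"] by simp
    finally have coeff: "(\<sigma>\<^sup>2 + 4 * x\<^sup>2 * (cmod y)\<^sup>2) * (u N t)\<^sup>2 \<le> (1 + 16 * (cmod y)\<^sup>2) * (u N t)\<^sup>2"
      by (rule mult_right_mono) simp
    have "4 * of_real (\<sigma> * x) * y * (e t * (of_real (u N t) * c N t))
        = of_real (2 * \<sigma> * u N t) * (2 * of_real x * y * e t * c N t)"
      by simp
    then have "Re (4 * of_real (\<sigma> * x) * y * (e t * (of_real (u N t) * c N t))) = 2 * \<sigma> * u N t * r"
      unfolding r_def by (simp only: Re_complex_of_real Im_complex_of_real times_complex.sel)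
    moreover have "u (Suc N) t = \<sigma> * u N t + r"
      by (simp add: u_Suc \<sigma>_def r_def x_def y_def e_def)
    ultimately show ?thesis
      using r2 coeff by (simp add: power2_eq_square algebra_simps)
  qed
  have "E (Suc N) \<le> (LINT t|circle. (1 + 16 * (cmod y)\<^sup>2) * (u N t)\<^sup>2
      + Re (4 * of_real (\<sigma> * x) * y * (e t * (of_real (u N t) * c N t))))"
    unfolding E_def
    by (intro integral_mono pointwise continuous_imp_integrable_circle continuous_intros cont_e)
  also have "\<dots> = (LINT t|circle. (1 + 16 * (cmod y)\<^sup>2) * (u N t)\<^sup>2)
      + (LINT t|circle. Re (4 * of_real (\<sigma> * x) * y * (e t * (of_real (u N t) * c N t))))"
    by (intro Bochner_Integration.integral_add continuous_imp_integrable_circle continuous_intros cont_e)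
  also have "(LINT t|circle. Re (4 * of_real (\<sigma> * x) * y * (e t * (of_real (u N t) * c N t))))
      = Re (LINT t|circle. 4 * of_real (\<sigma> * x) * y * (e t * (of_real (u N t) * c N t)))"
    by (intro integral_Re_circle continuous_intros cont_e)
  also have "(LINT t|circle. 4 * of_real (\<sigma> * x) * y * (e t * (of_real (u N t) * c N t)))
      = 4 * of_real (\<sigma> * x) * y * W"
    by (simp add: W_def)
  also have "Re (4 * of_real (\<sigma> * x) * y * W) \<le> cmod (4 * of_real (\<sigma> * x) * y * W)"
    by (rule complex_Re_le_cmod)
  also have "\<dots> = 4 * (\<sigma> * x) * (cmod y * cmod W)"
    using \<sigma> x by (simp add: norm_mult)
  also have "\<dots> \<le> 18 * (cmod y * cmod W)"
    using mult_mono[OF \<sigma>(2) x(2)] \<sigma> x by (intro mult_right_mono) auto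
  finally show ?thesis
    by (simp add: E_def W_def y_def e_def)
qed

text \<open>By \<open>cross_term_le\<close> the mixed term is at most
  \<open>18 * 31 * |B (Suc n)| * |B n|\<close> times an earlier moment, hence 279 times the sum of
  the two squares. Adding 16 gives 295 per step, and each \<open>B j\<close> enters at most two
  steps, whence 590.\<close>

lemma E_le_exp:
  assumes "\<And>j. 1 \<le> j \<Longrightarrow> j \<le> N \<Longrightarrow> cmod (B j) \<le> 1"
  shows "E N \<le> exp (590 * (\<Sum>j=1..N. (cmod (B j))\<^sup>2))"
proof -
  \<comment> \<open>\<open>B 0\<close> belongs to no factor; the value 0 there makes the first step
    fit the general pattern.\<close>
  define \<beta> where "\<beta> j = (if j = 0 then 0 else (cmod (B j))\<^sup>2)" for j
  define S where "S n = (\<Sum>j=1..n. \<beta> j)" for n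
  \<comment> \<open>The exponent is 295 times the sum of \<open>\<beta> (i + 1) + \<beta> i\<close>
    over \<open>i < n\<close>.\<close>
  define X where "X n = exp (295 * (2 * S n - \<beta> n))" for n
  have \<beta>: "0 \<le> \<beta> n" for n by (simp add: \<beta>_def)
  have X_Suc: "X (Suc n) = exp (295 * (\<beta> (Suc n) + \<beta> n)) * X n" for n
    by (simp add: X_def S_def exp_add[symmetric] algebra_simps)
  have X_mono: "X n \<le> X (Suc n)" for n
    unfolding X_Suc using \<beta>[of n] \<beta>[of "Suc n"] by (simp add: X_def)
  \<comment> \<open>The cross term reaches two levels back, so the bound on \<open>E (n - 1)\<close>
    is carried along; at \<open>n = 0\<close> truncated subtraction makes both claims the
    same.\<close>
  have "n \<le> N \<Longrightarrow> E n \<le> X n \<and> E (n - 1) \<le> X n" for n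
  proof (induction n)
    case 0
    show ?case by (simp add: E_0 X_def S_def \<beta>_def)
  next
    case (Suc n)
    then have IH: "E n \<le> X n" "E (n - 1) \<le> X n" by auto
    have X0: "0 < X n" by (simp add: X_def)
    have B1: "cmod (B (Suc n)) \<le> 1" using assms[of "Suc n"] Suc.prems by simp
    define W where "W = cmod (LINT t|circle. character (int (m (Suc n))) t * (of_real (u n t) * c n t))"
    have "18 * cmod (B (Suc n)) * W \<le> 279 * (\<beta> (Suc n) + \<beta> n) * X n"
    proof (cases n)
      case 0
      then have "W = 0" by (simp add: W_def)
      then show ?thesis using \<beta>[of n] \<beta>[of "Suc n"] X0 by simp
    next
      case (Suc k)
      have "W \<le> 31 * cmod (B n) * E k"
        unfolding W_def Suc by (rule cross_term_le) (use assms[of n] Suc Suc.prems \<open>Suc n \<le> N\<close> in auto)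
      also have "\<dots> \<le> 31 * cmod (B n) * X n"
        using IH(2) Suc by (intro mult_left_mono) auto
      finally have "18 * cmod (B (Suc n)) * W \<le> 18 * cmod (B (Suc n)) * (31 * cmod (B n) * X n)"
        by (intro mult_left_mono) auto
      also have "\<dots> = 279 * (2 * cmod (B (Suc n)) * cmod (B n)) * X n"
        by simp
      also have "\<dots> \<le> 279 * (\<beta> (Suc n) + \<beta> n) * X n"
        using X0 sum_squares_bound[of "cmod (B (Suc n))" "cmod (B n)"] Suc
        by (intro mult_right_mono mult_left_mono) (auto simp: \<beta>_def)
      finally show ?thesis .
    qed
    moreover have "(1 + 16 * (cmod (B (Suc n)))\<^sup>2) * E n \<le> (1 + 16 * (\<beta> (Suc n) + \<beta> n)) * X n"
      using IH(1) \<beta>[of n] E_nonneg[of n] by (intro mult_mono) (auto simp: \<beta>_def)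
    ultimately have "E (Suc n) \<le> (1 + 16 * (\<beta> (Suc n) + \<beta> n)) * X n + 279 * (\<beta> (Suc n) + \<beta> n) * X n"
      using E_Suc_le[OF B1] by (simp add: W_def)
    also have "\<dots> = (1 + 295 * (\<beta> (Suc n) + \<beta> n)) * X n"
      by (simp add: algebra_simps)
    also have "\<dots> \<le> X (Suc n)"
      unfolding X_Suc using X0 by (intro mult_right_mono exp_ge_add_one_self) auto
    finally show ?case
      using IH(1) X_mono[of n] by simp
  qed
  then have "E N \<le> X N" by simp
  also have "\<dots> \<le> exp (590 * S N)"
    using \<beta>[of N] by (simp add: X_def)
  also have "S N = (\<Sum>j=1..N. (cmod (B j))\<^sup>2)"
    unfolding S_def by (rule sum.cong) (auto simp: \<beta>_def)
  finally show ?thesis .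
qed

end

subsection \<open>Convergence in the metric\<close>

lemma ennreal_tendsto_0I:
  assumes "\<And>e::real. 0 < e \<Longrightarrow> eventually (\<lambda>n. X n \<le> ennreal e) F"
  shows "(X \<longlongrightarrow> (0::ennreal)) F"
proof (rule order_tendstoI)
  fix a :: ennreal assume "0 < a"
  then obtain e where e: "0 < e" "ennreal e < a"
  proof (cases a rule: ennreal_cases)
    case (real x)
    with \<open>0 < a\<close> show ?thesis by (intro that[of "x / 2"]) (auto simp: ennreal_less_iff)
  next
    case top
    then show ?thesis by (intro that[of 1]) auto
  qed
  show "eventually (\<lambda>n. X n < a) F"
    using assms[OF e(1)] by eventually_elim (use e(2) in \<open>auto intro: le_less_trans\<close>)
qed simp

lemma ennreal_tendsto_0D:
  assumes "(X \<longlongrightarrow> (0::ennreal)) F" "0 < (e::real)"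
  shows "eventually (\<lambda>n. X n \<le> ennreal e) F"
proof -
  have "eventually (\<lambda>n. X n < ennreal e) F"
    using order_tendstoD(2)[OF assms(1)] assms(2) by simp
  then show ?thesis by eventually_elim simp
qed

lemma d_p_less_top_iff: "d_p p f g < \<infinity> \<longleftrightarrow> rho_int p f g < \<infinity>"
  by (auto simp: d_p_def less_top)

lemma d_p_le_iff:
  assumes "1 \<le> p" "0 < e"
  shows "d_p p f g \<le> ennreal e \<longleftrightarrow> rho_int p f g \<le> ennreal (e powr p)"
proof (cases "rho_int p f g" rule: ennreal_cases)
  case (real x)
  have "x powr (1 / p) \<le> e \<longleftrightarrow> x \<le> e powr p"
  proof
    assume "x powr (1 / p) \<le> e"
    then have "(x powr (1 / p)) powr p \<le> e powr p"
      using assms by (intro powr_mono2) auto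
    then show "x \<le> e powr p" using assms real by (simp add: powr_powr)
  next
    assume "x \<le> e powr p"
    then have "x powr (1 / p) \<le> (e powr p) powr (1 / p)"
      using assms real by (intro powr_mono2) auto
    then show "x powr (1 / p) \<le> e" using assms by (simp add: powr_powr)
  qed
  then show ?thesis using real assms by (simp add: d_p_def)
next
  case top
  then show ?thesis using assms by (simp add: d_p_def top_unique)
qed

text \<open>Reduces convergence to the integral \<open>rho_int\<close>, so that the cases
  \<open>p \<ge> 1\<close> and \<open>p < 1\<close> can be treated together afterwards.\<close>

lemma d_p_tendsto_0_iff:
  assumes "0 < p"
  shows "((\<lambda>N. d_p p (G N) g) \<longlongrightarrow> 0) F \<longleftrightarrow> ((\<lambda>N. rho_int p (G N) g) \<longlongrightarrow> 0) F"
proof (cases "1 \<le> p")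
  case True
  show ?thesis
  proof
    assume L: "((\<lambda>N. d_p p (G N) g) \<longlongrightarrow> 0) F"
    show "((\<lambda>N. rho_int p (G N) g) \<longlongrightarrow> 0) F"
    proof (rule ennreal_tendsto_0I)
      fix e :: real assume "0 < e"
      then have "eventually (\<lambda>N. d_p p (G N) g \<le> ennreal (e powr (1 / p))) F"
        by (intro ennreal_tendsto_0D[OF L]) simp
      then show "eventually (\<lambda>N. rho_int p (G N) g \<le> ennreal e) F"
        by eventually_elim (use d_p_le_iff[OF True, of "e powr (1 / p)"] \<open>0 < e\<close> True in \<open>simp add: powr_powr\<close>)
    qed
  next
    assume L: "((\<lambda>N. rho_int p (G N) g) \<longlongrightarrow> 0) F"
    show "((\<lambda>N. d_p p (G N) g) \<longlongrightarrow> 0) F"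
    proof (rule ennreal_tendsto_0I)
      fix e :: real assume "0 < e"
      then have "eventually (\<lambda>N. rho_int p (G N) g \<le> ennreal (e powr p)) F"
        by (intro ennreal_tendsto_0D[OF L]) simp
      then show "eventually (\<lambda>N. d_p p (G N) g \<le> ennreal e) F"
        by eventually_elim (use d_p_le_iff[OF True \<open>0 < e\<close>] in simp)
    qed
  qed
next
  case False
  then show ?thesis by (simp add: d_p_def)
qed

text \<open>Transfers mean square bounds to every exponent \<open>p > 0\<close>. Small
  \<open>x\<close> are absorbed by \<epsilon>. Otherwise
  \<open>ln (1 + x) \<le> (p / 2) * (1 + x) powr (2 / p)\<close>, whose \<open>p\<close>-th power is
  quadratic in \<open>1 + x\<close>, and \<open>1 + x\<close> is at most a constant times
  \<open>x\<close>.\<close>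

lemma ln_powr_le_eps_plus_square:
  fixes p \<epsilon> :: real
  assumes "0 < p" "0 < \<epsilon>"
  obtains C where "0 \<le> C" "\<And>x. 0 \<le> x \<Longrightarrow> ln (1 + x) powr p \<le> \<epsilon> + C * x\<^sup>2"
proof -
  define \<delta> where "\<delta> = \<epsilon> powr (1 / p)"
  define C where "C = (p / 2) powr p * (1 + 1 / \<delta>)\<^sup>2"
  have \<delta>: "0 < \<delta>" using assms by (simp add: \<delta>_def)
  have "ln (1 + x) powr p \<le> \<epsilon> + C * x\<^sup>2" if x: "0 \<le> x" for x
  proof (cases "ln (1 + x) \<le> \<delta>")
    case True
    then have "ln (1 + x) powr p \<le> \<delta> powr p"
      using x assms by (intro powr_mono2) auto
    also have "\<dots> = \<epsilon>" using assms by (simp add: \<delta>_def powr_powr)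
    finally show ?thesis by (simp add: C_def add_increasing2)
  next
    case False
    then have "\<delta> < x" using ln_add_one_self_le_self[OF x] by simp
    then have "1 + x \<le> (1 + 1 / \<delta>) * x" using \<delta> by (simp add: field_simps)
    then have le: "(1 + x)\<^sup>2 \<le> ((1 + 1 / \<delta>) * x)\<^sup>2" using x by (intro power_mono) auto
    have "ln (1 + x) \<le> (1 + x) powr (2 / p) / (2 / p)"
      using x assms by (intro ln_powr_bound) auto
    then have "ln (1 + x) powr p \<le> ((1 + x) powr (2 / p) * (p / 2)) powr p"
      using x assms by (intro powr_mono2) auto
    also have "\<dots> = ((1 + x) powr (2 / p)) powr p * (p / 2) powr p"
      using x assms by (intro powr_mult)
    also have "\<dots> = (1 + x)\<^sup>2 * (p / 2) powr p"
      using x assms by (simp add: powr_powr powr_numeral)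
    also have "\<dots> \<le> ((1 + 1 / \<delta>) * x)\<^sup>2 * (p / 2) powr p"
      by (intro mult_right_mono le) simp
    also have "\<dots> = C * x\<^sup>2"
      by (simp add: C_def power_mult_distrib)
    finally show ?thesis using assms by simp
  qed
  then show ?thesis using that[of C] by (auto simp: C_def)
qed

lemma prod_le_exp_sum:
  fixes f :: "nat \<Rightarrow> real"
  assumes "\<And>j. j \<in> S \<Longrightarrow> 0 \<le> f j"
  shows "(\<Prod>j\<in>S. 1 + f j) \<le> exp (\<Sum>j\<in>S. f j)"
proof (cases "finite S")
  case True
  have "(\<Prod>j\<in>S. 1 + f j) \<le> (\<Prod>j\<in>S. exp (f j))"
    using assms by (intro prod_mono) (auto intro: add_nonneg_nonneg)
  with True show ?thesis by (simp add: exp_sum)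
qed simp

lemma sum_le_prod:
  fixes f :: "nat \<Rightarrow> real"
  assumes "\<And>j. j \<in> S \<Longrightarrow> 0 \<le> f j" "finite S"
  shows "1 + (\<Sum>j\<in>S. f j) \<le> (\<Prod>j\<in>S. 1 + f j)"
  using assms(2,1)
proof (induction S rule: finite_induct)
  case (insert x S)
  have "1 + (\<Sum>j\<in>insert x S. f j) \<le> (1 + f x) * (1 + (\<Sum>j\<in>S. f j))"
    using insert by (simp add: algebra_simps sum_nonneg)
  also have "\<dots> \<le> (1 + f x) * (\<Prod>j\<in>S. 1 + f j)"
    using insert by (intro mult_left_mono) auto
  finally show ?case using insert by simp
qed simp

lemma partial_prod_add:
  "partial_prod m A B (n + k) t =
     partial_prod m A B n t ** partial_prod (\<lambda>j. m (n + j)) (\<lambda>j. A (n + j)) (\<lambda>j. B (n + j)) k t"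
  by (induction k) (simp_all add: matrix_mul_assoc)

text \<open>The entries of \<open>G ** (H - mat 1)\<close> are sums of products. Weighted AM-GM
  separates the size of \<open>G\<close> from the distance of \<open>H\<close> to the identity, so
  each can be integrated by itself, and \<kappa> balances the two parts.\<close>

lemma norm_SU11_mult_diff_le:
  assumes "G \<in> SU11" "H \<in> SU11" "0 < \<kappa>"
  shows "norm (G ** H - G) \<le> 2 * (\<kappa> * ((cmod (G$1$1))\<^sup>2 + (cmod (G$1$2))\<^sup>2)
     + ((cmod (H$1$1 - 1))\<^sup>2 + (cmod (H$1$2))\<^sup>2) / \<kappa>)"
proof -
  define x y where "x = cmod (G$1$1)" and "y = cmod (G$1$2)"
  define v w where "v = cmod (H$1$1 - 1)" and "w = cmod (H$1$2)"
  have cnj1: "cmod (cnj z - 1) = cmod (z - 1)" for z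
    by (metis complex_cnj_diff complex_cnj_one complex_mod_cnj)
  have GH: "G ** H \<in> SU11" by (intro SU11_mult assms)
  have "(G ** H - G)$1$1 = G$1$1 * (H$1$1 - 1) + G$1$2 * cnj (H$1$2)"
    by (simp add: mat2_mult_nth SU11_nth[OF assms(2)] algebra_simps)
  then have d1: "cmod ((G ** H - G)$1$1) \<le> x * v + y * w"
    using norm_triangle_ineq[of "G$1$1 * (H$1$1 - 1)" "G$1$2 * cnj (H$1$2)"]
    by (simp add: x_def y_def v_def w_def norm_mult)
  have "(G ** H - G)$1$2 = G$1$1 * H$1$2 + G$1$2 * (cnj (H$1$1) - 1)"
    by (simp add: mat2_mult_nth SU11_nth[OF assms(2)] algebra_simps)
  then have d2: "cmod ((G ** H - G)$1$2) \<le> x * w + y * v"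
    using norm_triangle_ineq[of "G$1$1 * H$1$2" "G$1$2 * (cnj (H$1$1) - 1)"]
    by (simp add: x_def y_def v_def w_def norm_mult cnj1)
  have n: "(G ** H - G)$2$1 = cnj ((G ** H - G)$1$2)" "(G ** H - G)$2$2 = cnj ((G ** H - G)$1$1)"
    by (simp_all add: SU11_nth[OF GH] SU11_nth[OF assms(1)])
  have "norm (G ** H - G) \<le> 2 * cmod ((G ** H - G)$1$1) + 2 * cmod ((G ** H - G)$1$2)"
    using norm_mat2_le[of "G ** H - G"] unfolding n complex_mod_cnj by linarith
  also have "\<dots> \<le> 2 * (x * v + y * w) + 2 * (x * w + y * v)"
    by (intro add_mono mult_left_mono d1 d2) auto
  finally have "norm (G ** H - G) \<le> 2 * (x * v + y * w) + 2 * (x * w + y * v)" .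
  moreover have amgm: "2 * (r * q) \<le> \<kappa> * r\<^sup>2 + q\<^sup>2 / \<kappa>" for r q :: real
  proof -
    have "0 \<le> (\<kappa> * r - q)\<^sup>2 / \<kappa>" using assms(3) by simp
    also have "\<dots> = \<kappa> * r\<^sup>2 + q\<^sup>2 / \<kappa> - 2 * (r * q)"
      using assms(3) by (simp add: power2_eq_square field_simps)
    finally show ?thesis by simp
  qed
  ultimately have "norm (G ** H - G) \<le> 2 * (\<kappa> * x\<^sup>2 + \<kappa> * y\<^sup>2 + v\<^sup>2 / \<kappa> + w\<^sup>2 / \<kappa>)"
    using amgm[of x v] amgm[of y w] amgm[of x w] amgm[of y v] by (simp add: algebra_simps)
  then show ?thesis
    by (simp add: x_def y_def v_def w_def algebra_simps add_divide_distrib)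
qed

text \<open>If the off-diagonal entry exceeds \<open>4 * \<eta>\<close>, then by
  \<open>offdiag_le_of_rho_le\<close> one of the two distances exceeds
  \<open>ln (1 + \<eta>)\<close>; this is the second claim. The first is a pointwise Paley-Zygmund
  argument: in that case \<open>z \<le> \<kappa> * z^2 + 1 / (4 * \<kappa>)\<close>, and the
  distances pay for the constant. It can be integrated directly, without isolating a set of large
  values.\<close>

lemma offdiag_sq_le:
  assumes SU: "G \<in> SU11" "H \<in> SU11" "K \<in> SU11" and p: "0 < p" and \<eta>: "0 < \<eta>" "\<eta> \<le> 1" and "0 < \<kappa>"
  shows "(cmod (H$1$2))\<^sup>2 \<le> 16 * \<eta>\<^sup>2 + \<kappa> * (cmod (H$1$2)) ^ 4
     + 1 / (4 * \<kappa> * ln (1 + \<eta>) powr p) * (rho G K powr p + rho (G ** H) K powr p)"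
    and "16 * \<eta>\<^sup>2 < (cmod (H$1$2))\<^sup>2 \<Longrightarrow> ln (1 + \<eta>) powr p \<le> rho G K powr p + rho (G ** H) K powr p"
proof -
  define \<theta> where "\<theta> = ln (1 + \<eta>) powr p"
  define z where "z = (cmod (H$1$2))\<^sup>2"
  have \<theta>: "0 < \<theta>" using \<eta> by (simp add: \<theta>_def)
  have big: "\<theta> \<le> rho G K powr p + rho (G ** H) K powr p" if "16 * \<eta>\<^sup>2 < z"
  proof (rule ccontr)
    assume neg: "\<not> ?thesis"
    have "rho G K \<le> ln (1 + \<eta>)"
    proof (rule ccontr)
      assume "\<not> ?thesis"
      then have "\<theta> \<le> rho G K powr p"
        unfolding \<theta>_def using p \<eta> by (intro powr_mono2) auto
      then show False using neg powr_ge_zero[of "rho (G ** H) K" p] by linarith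
    qed
    moreover have "rho (G ** H) K \<le> ln (1 + \<eta>)"
    proof (rule ccontr)
      assume "\<not> ?thesis"
      then have "\<theta> \<le> rho (G ** H) K powr p"
        unfolding \<theta>_def using p \<eta> by (intro powr_mono2) auto
      then show False using neg powr_ge_zero[of "rho G K" p] by linarith
    qed
    ultimately have "cmod (H$1$2) \<le> 2 * \<eta> * (1 + \<eta>)"
      using \<eta> by (intro offdiag_le_of_rho_le[OF SU]) auto
    also have "\<dots> \<le> 2 * \<eta> * 2"
      using \<eta> by (intro mult_left_mono) auto
    finally have "z \<le> (4 * \<eta>)\<^sup>2"
      unfolding z_def by (intro power_mono) auto
    with that show False by (simp add: power_mult_distrib)
  qed
  then show "16 * \<eta>\<^sup>2 < (cmod (H$1$2))\<^sup>2 \<Longrightarrow> ln (1 + \<eta>) powr p \<le> rho G K powr p + rho (G ** H) K powr p"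
    by (simp add: z_def \<theta>_def)
  define Q where "Q = rho G K powr p + rho (G ** H) K powr p"
  have Q: "0 \<le> Q" by (simp add: Q_def)
  have "z \<le> 16 * \<eta>\<^sup>2 + \<kappa> * z\<^sup>2 + 1 / (4 * \<kappa> * \<theta>) * Q"
  proof (cases "16 * \<eta>\<^sup>2 < z")
    case True
    have "0 \<le> (2 * \<kappa> * z - 1)\<^sup>2 / (4 * \<kappa>)" using \<open>0 < \<kappa>\<close> by simp
    also have "\<dots> = \<kappa> * z\<^sup>2 + 1 / (4 * \<kappa>) - z"
      using \<open>0 < \<kappa>\<close> by (simp add: power2_eq_square field_simps)
    finally have "z \<le> \<kappa> * z\<^sup>2 + 1 / (4 * \<kappa>)" by simp
    also have "1 / (4 * \<kappa>) = 1 / (4 * \<kappa> * \<theta>) * \<theta>" using \<theta> by simp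
    also have "\<dots> \<le> 1 / (4 * \<kappa> * \<theta>) * Q"
      using big[OF True] \<theta> \<open>0 < \<kappa>\<close> by (intro mult_left_mono) (auto simp: Q_def)
    finally show ?thesis using zero_le_power2[of \<eta>] by linarith
  next
    case False
    then show ?thesis using \<open>0 < \<kappa>\<close> \<theta> Q by (simp add: add_increasing2)
  qed
  then show "(cmod (H$1$2))\<^sup>2 \<le> 16 * \<eta>\<^sup>2 + \<kappa> * (cmod (H$1$2)) ^ 4
     + 1 / (4 * \<kappa> * ln (1 + \<eta>) powr p) * (rho G K powr p + rho (G ** H) K powr p)"
    by (simp add: z_def \<theta>_def Q_def power_mult[symmetric])
qed

lemma nn_integral_circle_le:
  assumes "continuous_on UNIV f" "\<And>t. 0 \<le> f t"
    and "\<And>t. t \<in> {0..<1} \<Longrightarrow> h t \<le> ennreal (f t)" "(LINT t|circle. f t) \<le> x"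
  shows "(\<integral>\<^sup>+ t. h t \<partial>circle) \<le> ennreal x"
proof -
  have "(\<integral>\<^sup>+ t. h t \<partial>circle) \<le> (\<integral>\<^sup>+ t. ennreal (f t) \<partial>circle)"
    by (rule nn_integral_mono) (simp add: assms(3))
  also have "\<dots> = ennreal (LINT t|circle. f t)"
    by (rule nn_integral_eq_integral) (use assms in \<open>auto intro: continuous_imp_integrable_circle\<close>)
  also have "\<dots> \<le> ennreal x"
    by (rule ennreal_leI) (rule assms)
  finally show ?thesis .
qed

section \<open>Square-summable coefficients give convergence\<close>

context lacunary_product
begin

abbreviation g :: "nat \<Rightarrow> real \<Rightarrow> cmat2" where "g \<equiv> partial_prod m A B"

abbreviation tail :: "nat \<Rightarrow> nat \<Rightarrow> real \<Rightarrow> cmat2" where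
  "tail n \<equiv> partial_prod (\<lambda>j. m (n + j)) (\<lambda>j. A (n + j)) (\<lambda>j. B (n + j))"

lemma shift: "lacunary_product (\<lambda>j. m (n + j)) (\<lambda>j. A (n + j)) (\<lambda>j. B (n + j))"
  by unfold_locales (use m_pos m_double A_pos A_sq in \<open>auto simp: add.commute\<close>)

lemma tail_in_SU11: "tail n k t \<in> SU11"
  by (rule lacunary_product.partial_prod_in_SU11[OF shift])

text \<open>The bound of \<open>integral_distance_one\<close> for the block of factors
  \<open>n + 1\<close> to \<open>n + k\<close>.\<close>

definition excess :: "nat \<Rightarrow> nat \<Rightarrow> real" where
  "excess n k = (\<Prod>j=1..k. s (n + j)) - 1"

lemma continuous_distance_one:
  "continuous_on UNIV (\<lambda>t. (cmod (tail n k t$1$1 - 1))\<^sup>2 + (cmod (tail n k t$1$2))\<^sup>2)"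
  by (intro continuous_intros lacunary_product.continuous_partial_prod[OF shift])

lemma integral_tail_distance_one:
  "(LINT t|circle. (cmod (tail n k t$1$1 - 1))\<^sup>2 + (cmod (tail n k t$1$2))\<^sup>2) \<le> excess n k"
  using lacunary_product.integral_distance_one[OF shift[of n], of k]
  by (simp add: lacunary_product.a_def[OF shift] lacunary_product.b_def[OF shift]
      lacunary_product.s_def[OF shift] s_def excess_def)

text \<open>Left invariance reduces the distance to that of the block from the identity. \<epsilon>
  and \<open>C\<close> stay free, to be fixed before \<open>n\<close> is taken large.\<close>

lemma rho_int_tail_le:
  assumes "0 \<le> C" "0 < \<epsilon>" and C: "\<And>x. 0 \<le> x \<Longrightarrow> ln (1 + x) powr p \<le> \<epsilon> + C * x\<^sup>2"
  shows "rho_int p (g n) (g (n + k)) \<le> ennreal (\<epsilon> + 8 * C * excess n k)"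
proof -
  let ?d = "\<lambda>t. (cmod (tail n k t$1$1 - 1))\<^sup>2 + (cmod (tail n k t$1$2))\<^sup>2"
  show ?thesis
    unfolding rho_int_def
  proof (rule nn_integral_circle_le)
    show "continuous_on UNIV (\<lambda>t. \<epsilon> + 8 * C * ?d t)"
      by (intro continuous_intros continuous_distance_one)
    show "0 \<le> \<epsilon> + 8 * C * ?d t" for t using assms by simp
    show "ennreal (rho (g n t) (g (n + k) t) powr p) \<le> ennreal (\<epsilon> + 8 * C * ?d t)" for t
    proof (rule ennreal_leI)
      have "rho (g n t) (g (n + k) t) powr p = ln (1 + opnorm (tail n k t - mat 1)) powr p"
        by (simp add: partial_prod_add rho_mult[OF partial_prod_in_SU11])
      also have "\<dots> \<le> \<epsilon> + C * (opnorm (tail n k t - mat 1))\<^sup>2"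
        by (rule C) (rule opnorm_nonneg)
      also have "\<dots> \<le> \<epsilon> + C * (8 * ?d t)"
        using assms by (intro add_left_mono mult_left_mono opnorm_minus_one_le tail_in_SU11)
      finally show "rho (g n t) (g (n + k) t) powr p \<le> \<epsilon> + 8 * C * ?d t" by (simp add: mult_ac)
    qed
    have "(LINT t|circle. \<epsilon> + 8 * C * ?d t) = (LINT t|circle. \<epsilon>) + (LINT t|circle. 8 * C * ?d t)"
      by (intro Bochner_Integration.integral_add continuous_imp_integrable_circle continuous_intros continuous_distance_one)
    also have "\<dots> = \<epsilon> + 8 * C * (LINT t|circle. ?d t)"
      by simp
    also have "\<dots> \<le> \<epsilon> + 8 * C * excess n k"
      using assms by (intro add_left_mono mult_left_mono integral_tail_distance_one) auto
    finally show "(LINT t|circle. \<epsilon> + 8 * C * ?d t) \<le> \<epsilon> + 8 * C * excess n k" .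
  qed
qed

text \<open>Controls the matrix increments themselves, which serves to find a pointwise
  limit.\<close>

lemma nn_integral_increment_le:
  assumes "0 < \<kappa>"
  shows "(\<integral>\<^sup>+ t. ennreal (norm (g (n + k) t - g n t)) \<partial>circle)
     \<le> ennreal (2 * (\<kappa> * (\<Prod>j=1..n. s j) + excess n k / \<kappa>))"
proof -
  let ?d = "\<lambda>t. (cmod (tail n k t$1$1 - 1))\<^sup>2 + (cmod (tail n k t$1$2))\<^sup>2"
  show ?thesis
  proof (rule nn_integral_circle_le)
    show "continuous_on UNIV (\<lambda>t. 2 * (\<kappa> * u n t + ?d t / \<kappa>))"
      using assms by (intro continuous_intros continuous_distance_one) auto
    show "0 \<le> 2 * (\<kappa> * u n t + ?d t / \<kappa>)" for t
      using assms u_ge_1[of n t] by simp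
    show "ennreal (norm (g (n + k) t - g n t)) \<le> ennreal (2 * (\<kappa> * u n t + ?d t / \<kappa>))" for t
      unfolding partial_prod_add u_def a_def b_def
      by (intro ennreal_leI norm_SU11_mult_diff_le partial_prod_in_SU11 tail_in_SU11 assms)
    have "(LINT t|circle. 2 * (\<kappa> * u n t + ?d t / \<kappa>)) = (LINT t|circle. 2 * \<kappa> * u n t + (2 / \<kappa>) * ?d t)"
      by (simp add: algebra_simps add_divide_distrib)
    also have "\<dots> = (LINT t|circle. 2 * \<kappa> * u n t) + (LINT t|circle. (2 / \<kappa>) * ?d t)"
      by (intro Bochner_Integration.integral_add continuous_imp_integrable_circle continuous_intros continuous_distance_one)
    also have "\<dots> = 2 * \<kappa> * (\<Prod>j=1..n. s j) + (2 / \<kappa>) * (LINT t|circle. ?d t)"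
      by (simp only: integral_mult_right_zero integral_u)
    also have "\<dots> \<le> 2 * \<kappa> * (\<Prod>j=1..n. s j) + (2 / \<kappa>) * excess n k"
      using assms by (intro add_left_mono mult_left_mono integral_tail_distance_one) auto
    finally show "(LINT t|circle. 2 * (\<kappa> * u n t + ?d t / \<kappa>)) \<le> 2 * (\<kappa> * (\<Prod>j=1..n. s j) + excess n k / \<kappa>)"
      by (simp add: algebra_simps)
  qed
qed

text \<open>The bound is uniform in the block length \<open>k\<close> and tends to 0 with the tail
  of the series.\<close>

lemma excess_le:
  assumes "summable (\<lambda>j. (cmod (B (Suc j)))\<^sup>2)"
  shows "excess n k \<le> exp (2 * (\<Sum>j. (cmod (B (Suc (j + n))))\<^sup>2)) - 1"
proof -
  have "(\<Prod>j=1..k. s (n + j)) = (\<Prod>j=1..k. 1 + 2 * (cmod (B (n + j)))\<^sup>2)"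
    by (rule prod.cong) (auto simp: s_eq)
  also have "\<dots> \<le> exp (\<Sum>j=1..k. 2 * (cmod (B (n + j)))\<^sup>2)"
    by (rule prod_le_exp_sum) simp
  also have "(\<Sum>j=1..k. 2 * (cmod (B (n + j)))\<^sup>2) = 2 * (\<Sum>j<k. (cmod (B (Suc (j + n))))\<^sup>2)"
    by (simp add: sum_distrib_left sum.atLeast1_atMost_eq add.commute)
  also have "(\<Sum>j<k. (cmod (B (Suc (j + n))))\<^sup>2) \<le> (\<Sum>j. (cmod (B (Suc (j + n))))\<^sup>2)"
    using summable_ignore_initial_segment[OF assms, of n] by (intro sum_le_suminf) auto
  finally show ?thesis
    by (simp add: excess_def)
qed

text \<open>Completeness by construction: the increments along the subsequence have summable
  integrals, so their sum is finite almost everywhere and the partial products converge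
  there.\<close>

lemma subsequence_limit:
  assumes r: "\<And>k. r k \<le> r (Suc k)" and K: "\<And>n. (\<Prod>j=1..n. s j) \<le> K"
    and ex: "\<And>k i. excess (r k) i \<le> (1 / 16) ^ k"
  obtains h where "h \<in> borel_measurable circle" "\<And>t. h t \<in> SU11"
    "AE t in circle. (\<lambda>k. g (r k) t) \<longlonglongrightarrow> h t"
proof
  \<comment> \<open>The default \<open>mat 1\<close> off the Cauchy set keeps \<open>h\<close> in
    the group at every point, as \<open>in_Lp\<close> demands.\<close>
  define h where "h t = (if Cauchy (\<lambda>k. g (r k) t) then lim (\<lambda>k. g (r k) t) else mat 1)" for t
  have meas: "g n \<in> borel_measurable circle" for n
    by (intro continuous_imp_measurable_circle continuous_partial_prod)
  have lim: "(\<lambda>k. g (r k) t) \<longlonglongrightarrow> h t" if "Cauchy (\<lambda>k. g (r k) t)" for t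
    using that by (simp add: h_def Cauchy_convergent_iff convergent_LIMSEQ_iff)
  show "h \<in> borel_measurable circle"
    unfolding h_def[abs_def]
    by (intro measurable_If borel_measurable_lim_metric meas sets_Collect_Cauchy) auto
  show "h t \<in> SU11" for t
  proof (cases "Cauchy (\<lambda>k. g (r k) t)")
    case True
    show ?thesis
      by (rule closed_sequentially[OF closed_SU11 _ lim[OF True]]) (rule partial_prod_in_SU11)
  qed (simp add: h_def)
  define D where "D k t = norm (g (r (Suc k)) t - g (r k) t)" for k t
  have Dm: "(\<lambda>t. ennreal (D k t)) \<in> borel_measurable circle" for k
    unfolding D_def using meas by measurable
  have "1 \<le> K" using K[of 0] by simp
  have D_int: "(\<integral>\<^sup>+ t. ennreal (D k t) \<partial>circle) \<le> ennreal (2 * (K + 1) * (1 / 4) ^ k)" for k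
  proof -
    obtain i where i: "r (Suc k) = r k + i" using r le_iff_add by blast
    have "(\<integral>\<^sup>+ t. ennreal (D k t) \<partial>circle)
        \<le> ennreal (2 * ((1 / 4) ^ k * (\<Prod>j=1..r k. s j) + excess (r k) i / (1 / 4) ^ k))"
      unfolding D_def i by (rule nn_integral_increment_le) simp
    \<comment> \<open>The weight \<open>\<kappa> = (1 / 4) ^ k\<close> balances both parts: dividing
      \<open>(1 / 16) ^ k\<close> by it leaves \<open>(1 / 4) ^ k\<close>.\<close>
    also have "\<dots> \<le> ennreal (2 * ((1 / 4) ^ k * K + (1 / 16) ^ k / (1 / 4) ^ k))"
      by (intro ennreal_leI mult_left_mono add_mono divide_right_mono K ex) auto
    also have "(1 / 16 :: real) ^ k / (1 / 4) ^ k = (1 / 4) ^ k"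
      by (simp add: power_divide[symmetric])
    finally show ?thesis by (simp add: algebra_simps)
  qed
  have "(\<integral>\<^sup>+ t. (\<Sum>k. ennreal (D k t)) \<partial>circle) = (\<Sum>k. \<integral>\<^sup>+ t. ennreal (D k t) \<partial>circle)"
    by (rule nn_integral_suminf[OF Dm])
  also have "\<dots> \<le> (\<Sum>k. ennreal (2 * (K + 1) * (1 / 4) ^ k))"
    by (intro suminf_le D_int) auto
  also have "\<dots> = ennreal (\<Sum>k. 2 * (K + 1) * (1 / 4) ^ k)"
    using \<open>1 \<le> K\<close> by (intro suminf_ennreal2 summable_mult summable_geometric) auto
  also have "\<dots> < \<infinity>" by simp
  finally have fin: "(\<integral>\<^sup>+ t. (\<Sum>k. ennreal (D k t)) \<partial>circle) \<noteq> \<infinity>"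
    by simp
  have "(\<lambda>t. \<Sum>k. ennreal (D k t)) \<in> borel_measurable circle"
    using Dm by measurable
  from nn_integral_PInf_AE[OF this fin] have "AE t in circle. (\<Sum>k. ennreal (D k t)) \<noteq> \<infinity>" .
  then show "AE t in circle. (\<lambda>k. g (r k) t) \<longlonglongrightarrow> h t"
  proof eventually_elim
    case (elim t)
    then have "summable (\<lambda>k. D k t)"
      by (intro summable_suminf_not_top) (auto simp: D_def)
    then have "summable (\<lambda>k. g (r (Suc k)) t - g (r k) t)"
      unfolding D_def by (rule summable_norm_cancel)
    then have "convergent (\<lambda>n. \<Sum>k<n. g (r (Suc k)) t - g (r k) t)"
      by (simp add: summable_iff_convergent)
    then have "convergent (\<lambda>n. g (r n) t - g (r 0) t)"
      by (simp add: sum_lessThan_telescope[of "\<lambda>k. g (r k) t"])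
    then have "convergent (\<lambda>n. (g (r n) t - g (r 0) t) + g (r 0) t)"
      by (intro convergent_add convergent_const)
    then have "convergent (\<lambda>n. g (r n) t)" by simp
    then show ?case by (intro lim convergent_Cauchy)
  qed
qed

lemma convergent_if_summable:
  assumes sm: "summable (\<lambda>j. (cmod (B (Suc j)))\<^sup>2)" and "0 < p"
  shows "Lp_convergent p g"
proof -
  define \<tau> where "\<tau> n = exp (2 * (\<Sum>j. (cmod (B (Suc (j + n))))\<^sup>2)) - 1" for n
  have ex_le: "excess n k \<le> \<tau> n" for n k
    unfolding \<tau>_def by (rule excess_le[OF sm])
  have "(\<lambda>n. exp (2 * (\<Sum>j. (cmod (B (Suc (j + n))))\<^sup>2)) - 1) \<longlonglongrightarrow> exp (2 * 0) - 1"
    by (intro tendsto_intros suminf_exist_split2[OF sm])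
  then have \<tau>: "\<tau> \<longlonglongrightarrow> 0" by (simp add: \<tau>_def[abs_def])
  have "\<exists>n0. \<forall>n\<ge>n0. \<tau> n < (1 / 16) ^ k" for k
    using order_tendstoD(2)[OF \<tau>, of "(1 / 16) ^ k"] by (simp add: eventually_sequentially)
  then obtain n0 where n0: "\<And>k n. n0 k \<le> n \<Longrightarrow> \<tau> n < (1 / 16) ^ k" by metis
  \<comment> \<open>The sum makes \<open>r\<close> monotone and at least \<open>n0 k\<close>; the
    summand \<open>k\<close> makes it unbounded, so that it passes every \<open>n\<close>.\<close>
  define r where "r k = k + (\<Sum>i\<le>k. n0 i)" for k
  have r_ge: "n0 k \<le> r k" for k
    using member_le_sum[of k "{..k}" n0] by (simp add: r_def trans_le_add2)
  have K: "(\<Prod>j=1..n. s j) \<le> 1 + \<tau> 0" for n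
    using ex_le[of 0 n] by (simp add: excess_def)
  have r_mono: "r k \<le> r (Suc k)" for k by (simp add: r_def)
  have r_excess: "excess (r k) i \<le> (1 / 16) ^ k" for k i
    using ex_le[of "r k" i] n0[OF r_ge[of k]] by linarith
  obtain h where h: "h \<in> borel_measurable circle" "\<And>t. h t \<in> SU11"
    "AE t in circle. (\<lambda>k. g (r k) t) \<longlonglongrightarrow> h t"
    using subsequence_limit[of r, OF r_mono K r_excess] by blast
  \<comment> \<open>Fatou's lemma carries the bound for \<open>g n\<close> against
    \<open>g (r k)\<close>, uniform in large \<open>k\<close>, over to the limit
    \<open>h\<close>.\<close>
  have bound: "rho_int p (g n) h \<le> ennreal (\<epsilon> + 8 * C * \<tau> n)"
    if C: "0 \<le> C" "0 < \<epsilon>" "\<And>x. 0 \<le> x \<Longrightarrow> ln (1 + x) powr p \<le> \<epsilon> + C * x\<^sup>2" for n C \<epsilon>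
  proof -
    let ?f = "\<lambda>k t. ennreal (rho (g n t) (g (r k) t) powr p)"
    have meas: "?f k \<in> borel_measurable circle" for k
    proof -
      have "(\<lambda>t. rho (g n t) (g (r k) t)) \<in> borel_measurable circle"
        by (intro rho_measurable continuous_imp_measurable_circle continuous_partial_prod partial_prod_in_SU11)
      then show ?thesis by measurable
    qed
    have "rho_int p (g n) h \<le> (\<integral>\<^sup>+ t. liminf (\<lambda>k. ?f k t) \<partial>circle)"
      unfolding rho_int_def
    proof (rule nn_integral_mono_AE)
      show "AE t in circle. ennreal (rho (g n t) (h t) powr p) \<le> liminf (\<lambda>k. ?f k t)"
        using h(3)
      proof eventually_elim
        case (elim t)
        have "(\<lambda>k. rho (g n t) (g (r k) t)) \<longlonglongrightarrow> rho (g n t) (h t)"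
          by (intro tendsto_rho partial_prod_in_SU11 elim)
        then have "(\<lambda>k. rho (g n t) (g (r k) t) powr p) \<longlonglongrightarrow> rho (g n t) (h t) powr p"
          using \<open>0 < p\<close> by (intro tendsto_powr2) (auto simp: rho_nonneg)
        then have "(\<lambda>k. ?f k t) \<longlonglongrightarrow> ennreal (rho (g n t) (h t) powr p)"
          by (rule tendsto_ennrealI)
        then have "liminf (\<lambda>k. ?f k t) = ennreal (rho (g n t) (h t) powr p)"
          by (intro lim_imp_Liminf) auto
        then show ?case by simp
      qed
    qed
    also have "\<dots> \<le> liminf (\<lambda>k. integral\<^sup>N circle (?f k))"
      by (rule nn_integral_liminf[OF meas])
    also have "\<dots> = liminf (\<lambda>k. rho_int p (g n) (g (r k)))"
      by (simp add: rho_int_def)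
    also have "\<dots> \<le> liminf (\<lambda>k. ennreal (\<epsilon> + 8 * C * \<tau> n))"
    proof (rule Liminf_mono)
      show "\<forall>\<^sub>F k in sequentially. rho_int p (g n) (g (r k)) \<le> ennreal (\<epsilon> + 8 * C * \<tau> n)"
        using eventually_ge_at_top[of n]
      proof eventually_elim
        case (elim k)
        then have "n \<le> r k" by (simp add: r_def)
        then obtain i where i: "r k = n + i" using le_iff_add by blast
        have "rho_int p (g n) (g (r k)) \<le> ennreal (\<epsilon> + 8 * C * excess n i)"
          unfolding i by (rule rho_int_tail_le[OF C])
        also have "\<dots> \<le> ennreal (\<epsilon> + 8 * C * \<tau> n)"
          using C by (intro ennreal_leI add_left_mono mult_left_mono ex_le) auto
        finally show ?case .
      qed
    qed
    also have "\<dots> = ennreal (\<epsilon> + 8 * C * \<tau> n)"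
      by (simp add: Liminf_const)
    finally show ?thesis .
  qed
  \<comment> \<open>\<open>g 0\<close> is the identity, so the bound at \<open>n = 0\<close> yields
    membership of \<open>h\<close> in the space.\<close>
  have "rho_int p (g 0) h < \<infinity>"
  proof -
    obtain C where C: "0 \<le> C" "\<And>x. 0 \<le> x \<Longrightarrow> ln (1 + x) powr p \<le> 1 + C * x\<^sup>2"
      using ln_powr_le_eps_plus_square[OF \<open>0 < p\<close>, of 1] by auto
    show ?thesis
      by (rule le_less_trans[OF bound[OF C(1) _ C(2)]]) auto
  qed
  moreover have "g 0 = Id_fun"
    by (simp add: fun_eq_iff Id_fun_def)
  ultimately have "in_Lp p h"
    using h unfolding in_Lp_def d_p_less_top_iff by auto
  moreover have "(\<lambda>n. rho_int p (g n) h) \<longlonglongrightarrow> 0"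
  proof (rule ennreal_tendsto_0I)
    fix e :: real assume "0 < e"
    \<comment> \<open>The order of choice is: half of \<open>e\<close>, then \<open>C\<close>, then
      \<open>n\<close> so large that \<open>8 * C * \<tau> n\<close> stays below the other
      half.\<close>
    then obtain C where C: "0 \<le> C" "\<And>x. 0 \<le> x \<Longrightarrow> ln (1 + x) powr p \<le> e / 2 + C * x\<^sup>2"
      using ln_powr_le_eps_plus_square[OF \<open>0 < p\<close>, of "e / 2"] by auto
    have "(\<lambda>n. e / 2 + 8 * C * \<tau> n) \<longlonglongrightarrow> e / 2 + 8 * C * 0"
      by (intro tendsto_intros \<tau>)
    then have "\<forall>\<^sub>F n in sequentially. e / 2 + 8 * C * \<tau> n < e"
      using \<open>0 < e\<close> by (intro order_tendstoD(2)[of _ "e / 2"]) auto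
    then show "\<forall>\<^sub>F n in sequentially. rho_int p (g n) h \<le> ennreal e"
    proof eventually_elim
      case (elim n)
      have "rho_int p (g n) h \<le> ennreal (e / 2 + 8 * C * \<tau> n)"
        using \<open>0 < e\<close> by (intro bound[OF C(1) _ C(2)]) auto
      also have "\<dots> \<le> ennreal e"
        using elim by (intro ennreal_leI) auto
      finally show ?case .
    qed
  qed
  ultimately show ?thesis
    unfolding Lp_convergent_def d_p_tendsto_0_iff[OF \<open>0 < p\<close>] by blast
qed

end

section \<open>Convergence forces square-summable coefficients\<close>

lemma ennreal_add_mult:
  assumes "0 \<le> x" "0 \<le> y" "0 \<le> z" "0 \<le> w"
  shows "ennreal (x + y * (z + w)) = ennreal x + ennreal y * (ennreal z + ennreal w)"
proof -
  have "ennreal (x + y * (z + w)) = ennreal x + ennreal (y * (z + w))"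
    using assms by (intro ennreal_plus) auto
  also have "ennreal (y * (z + w)) = ennreal y * ennreal (z + w)"
    using assms by (intro ennreal_mult) auto
  finally show ?thesis
    using assms by (simp only: ennreal_plus)
qed

context lacunary_product
begin

lemma rho_powr_measurable:
  assumes "in_Lp p h"
  shows "(\<lambda>t. ennreal (rho (g n t) (h t) powr p)) \<in> borel_measurable circle"
proof -
  have h: "h \<in> borel_measurable circle"
    using assms by (simp add: in_Lp_def)
  have "(\<lambda>t. rho (g n t) (h t)) \<in> borel_measurable circle"
    by (rule rho_measurable[OF continuous_imp_measurable_circle[OF continuous_partial_prod] h partial_prod_in_SU11])
  then show ?thesis by measurable
qed

text \<open>A single factor has an off-diagonal entry of constant modulus \<open>|B|\<close>. With
  \<open>\<eta> = 1 / 4\<close> the threshold \<open>16 * \<eta>^2\<close> is 1, so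
  \<open>|B| > 1\<close> would bound the sum of two consecutive distances (to the power
  \<open>p\<close>) below by \<theta> at every point, while each integral is eventually at most
  \<open>\<theta> / 3\<close>. The fourth moment estimate requires this bound on
  \<open>|B|\<close>.\<close>

lemma eventually_norm_B_le_1:
  assumes h: "in_Lp p h" and "0 < p" and lim: "(\<lambda>n. rho_int p (g n) h) \<longlonglongrightarrow> 0"
  shows "eventually (\<lambda>n. cmod (B (Suc n)) \<le> 1) sequentially"
proof -
  define \<theta> :: real where "\<theta> = ln (1 + 1 / 4) powr p"
  have \<theta>: "0 < \<theta>" by (simp add: \<theta>_def)
  have ev: "\<forall>\<^sub>F n in sequentially. rho_int p (g n) h \<le> ennreal (\<theta> / 3)"
    using \<theta> by (intro ennreal_tendsto_0D[OF lim]) simp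
  then have "\<forall>\<^sub>F n in sequentially. rho_int p (g (Suc n)) h \<le> ennreal (\<theta> / 3)"
    using eventually_sequentially_Suc[of "\<lambda>n. rho_int p (g n) h \<le> ennreal (\<theta> / 3)"] by simp
  with ev show ?thesis
  proof eventually_elim
    case (elim n)
    show ?case
    proof (rule ccontr)
      assume "\<not> cmod (B (Suc n)) \<le> 1"
      then have big: "1 < (cmod (B (Suc n)))\<^sup>2" by (simp add: one_less_power)
      have "ennreal \<theta> = (\<integral>\<^sup>+ t. ennreal \<theta> \<partial>circle)"
        by simp
      also have "\<dots> \<le> (\<integral>\<^sup>+ t. ennreal (rho (g n t) (h t) powr p) + ennreal (rho (g (Suc n) t) (h t) powr p) \<partial>circle)"
      proof (rule nn_integral_mono)
        fix t assume t: "t \<in> space circle"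
        have "\<theta> \<le> rho (g n t) (h t) powr p + rho (g (Suc n) t) (h t) powr p"
          unfolding \<theta>_def partial_prod.simps
          by (rule offdiag_sq_le(2)[where \<kappa> = 1])
            (use h t big \<open>0 < p\<close> in \<open>auto simp: in_Lp_def partial_prod_in_SU11 factor_in_SU11 norm_mult power2_eq_square\<close>)
        then show "ennreal \<theta> \<le> ennreal (rho (g n t) (h t) powr p) + ennreal (rho (g (Suc n) t) (h t) powr p)"
          by (simp add: ennreal_plus[symmetric] del: ennreal_plus partial_prod.simps)
      qed
      also have "\<dots> = rho_int p (g n) h + rho_int p (g (Suc n)) h"
        unfolding rho_int_def by (intro nn_integral_add rho_powr_measurable h)
      also have "\<dots> \<le> ennreal (\<theta> / 3) + ennreal (\<theta> / 3)"
        by (intro add_mono elim)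
      also have "\<dots> = ennreal (\<theta> / 3 + \<theta> / 3)"
        using \<theta> by (intro ennreal_plus[symmetric]) auto
      finally have "\<theta> \<le> \<theta> / 3 + \<theta> / 3"
        using \<theta> by (subst (asm) ennreal_le_iff) auto
      then show False using \<theta> by simp
    qed
  qed
qed

text \<open>The exact mean of \<open>|b|^2\<close>, combined with the Bernoulli-type inequality for
  the product of the \<open>1 + 2 * |B|^2\<close>.\<close>

lemma tail_second_moment_ge:
  "(\<Sum>j=1..k. (cmod (B (n + j)))\<^sup>2) \<le> (LINT t|circle. (cmod (tail n k t$1$2))\<^sup>2)"
proof -
  have "1 + (\<Sum>j=1..k. 2 * (cmod (B (n + j)))\<^sup>2) \<le> (\<Prod>j=1..k. 1 + 2 * (cmod (B (n + j)))\<^sup>2)"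
    by (rule sum_le_prod) auto
  also have "\<dots> = (\<Prod>j=1..k. s (n + j))"
    by (rule prod.cong) (auto simp: s_eq)
  finally have le: "1 + 2 * (\<Sum>j=1..k. (cmod (B (n + j)))\<^sup>2) \<le> (\<Prod>j=1..k. s (n + j))"
    by (simp only: sum_distrib_left)
  have eq: "(LINT t|circle. (cmod (tail n k t$1$2))\<^sup>2) = ((\<Prod>j=1..k. s (n + j)) - 1) / 2"
    using lacunary_product.integral_norm_b_sq[OF shift[of n], of k]
    by (simp only: lacunary_product.b_def[OF shift] lacunary_product.s_def[OF shift] s_def)
  have "x \<le> (y - 1) / 2" if "1 + 2 * x \<le> y" for x y :: real
    using that by simp
  from this[OF le] show ?thesis unfolding eq .
qed

lemma tail_fourth_moment_le:
  assumes "\<And>j. 1 \<le> j \<Longrightarrow> j \<le> k \<Longrightarrow> cmod (B (n + j)) \<le> 1"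
  shows "(LINT t|circle. (cmod (tail n k t$1$2)) ^ 4) \<le> exp (590 * (\<Sum>j=1..k. (cmod (B (n + j)))\<^sup>2))"
proof -
  interpret T: lacunary_product "\<lambda>j. m (n + j)" "\<lambda>j. A (n + j)" "\<lambda>j. B (n + j)"
    by (rule shift)
  have "(LINT t|circle. (cmod (T.b k t)) ^ 4) \<le> T.E k"
    unfolding T.E_def
  proof (rule integral_mono)
    show "integrable circle (\<lambda>t. (cmod (T.b k t)) ^ 4)" "integrable circle (\<lambda>t. (T.u k t)\<^sup>2)"
      by (intro continuous_imp_integrable_circle continuous_intros T.continuous_b T.continuous_u)+
    fix t
    have "((cmod (T.b k t))\<^sup>2)\<^sup>2 \<le> (T.u k t)\<^sup>2"
      by (rule power_mono) (simp_all add: T.u_def)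
    then show "(cmod (T.b k t)) ^ 4 \<le> (T.u k t)\<^sup>2"
      by (simp add: power_mult[symmetric])
  qed
  also have "T.E k \<le> exp (590 * (\<Sum>j=1..k. (cmod (B (n + j)))\<^sup>2))"
    by (rule T.E_le_exp) (rule assms)
  finally show ?thesis by (simp add: T.b_def)
qed

text \<open>On a block of squared \<open>\<ell>\<^sup>2\<close> mass between 1 and 2 the off-diagonal entry has second moment at least 1
  and bounded fourth moment, so it cannot be small outside a set of small measure.\<close>

lemma summable_if_convergent:
  assumes "Lp_convergent p g" and "0 < p"
  shows "summable (\<lambda>j. (cmod (B (Suc j)))\<^sup>2)"
proof (rule ccontr)
  assume nsm: "\<not> ?thesis"
  from assms(1) obtain h where h: "in_Lp p h" and "(\<lambda>n. d_p p (g n) h) \<longlonglongrightarrow> 0"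
    by (auto simp: Lp_convergent_def)
  then have lim: "(\<lambda>n. rho_int p (g n) h) \<longlonglongrightarrow> 0"
    by (simp add: d_p_tendsto_0_iff[OF \<open>0 < p\<close>])
  \<comment> \<open>Budget for the contradiction: \<open>M\<close> bounds the fourth moment of a
    block of mass at most 2. The choice \<open>\<eta> = 1 / 8\<close> costs 1/4,
    \<open>\<kappa> = 1 / (4 * M)\<close> costs 1/4, and two distance integrals of at most
    \<open>\<theta> / (8 * M)\<close> cost 1/4. The total 3/4 is below the second moment, which is
    at least 1.\<close>
  define M :: real where "M = exp 1180"
  define \<theta> :: real where "\<theta> = ln (1 + 1 / 8) powr p"
  have M: "0 < M" and \<theta>: "0 < \<theta>" by (simp_all add: M_def \<theta>_def)
  have "\<forall>\<^sub>F n in sequentially. cmod (B (Suc n)) \<le> 1 \<and> rho_int p (g n) h \<le> ennreal (\<theta> / (8 * M))"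
    by (intro eventually_conj eventually_norm_B_le_1[OF h \<open>0 < p\<close> lim] ennreal_tendsto_0D[OF lim])
      (use \<theta> M in simp)
  then obtain n where n: "\<And>j. n \<le> j \<Longrightarrow> cmod (B (Suc j)) \<le> 1"
    "\<And>j. n \<le> j \<Longrightarrow> rho_int p (g j) h \<le> ennreal (\<theta> / (8 * M))"
    by (auto simp: eventually_sequentially)
  define S where "S k = (\<Sum>j=1..k. (cmod (B (n + j)))\<^sup>2)" for k
  have S_Suc: "S (Suc k) = S k + (cmod (B (Suc (n + k))))\<^sup>2" for k
    by (simp add: S_def)
  have B1: "(cmod (B (Suc (n + k))))\<^sup>2 \<le> 1" for k
    using n(1)[of "n + k"] by (simp add: power_le_one)
  \<comment> \<open>Otherwise the tail of the series would have partial sums bounded by 1.\<close>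
  have "\<exists>k. 1 \<le> S k"
  proof (rule ccontr)
    assume "\<not> ?thesis"
    then have "(\<Sum>j<k. (cmod (B (Suc (j + n))))\<^sup>2) \<le> 1" for k
      by (simp add: S_def sum.atLeast1_atMost_eq not_le less_imp_le add.commute)
    then have "summable (\<lambda>j. (cmod (B (Suc (j + n))))\<^sup>2)"
      by (intro bounded_imp_summable[of _ 1]) (simp_all only: lessThan_Suc_atMost[symmetric] zero_le_power2)
    then show False using nsm summable_iff_shift[of "\<lambda>j. (cmod (B (Suc j)))\<^sup>2" n] by simp
  qed
  \<comment> \<open>For the least such \<open>k\<close> the preceding sum is below 1, and one more
    term adds at most 1.\<close>
  then obtain k where k: "1 \<le> S k" "\<forall>i<k. \<not> 1 \<le> S i"
    unfolding exists_least_iff[of "\<lambda>k. 1 \<le> S k"] by blast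
  have "k \<noteq> 0" using k(1) by (cases k) (auto simp: S_def)
  then obtain i where i: "k = Suc i" using not0_implies_Suc by blast
  have "S i < 1" using k(2) i by (simp add: not_le)
  then have S2: "S k \<le> 2" using B1[of i] S_Suc[of i] i by simp
  let ?b = "\<lambda>t. cmod (tail n k t$1$2)"
  have cont: "continuous_on UNIV ?b"
    by (intro continuous_intros lacunary_product.continuous_partial_prod[OF shift])
  define \<kappa> where "\<kappa> = 1 / (4 * M)"
  have \<kappa>: "0 < \<kappa>" using M by (simp add: \<kappa>_def)
  let ?f = "\<lambda>i t. ennreal (rho (g i t) (h t) powr p)"
  have "1 \<le> (LINT t|circle. (?b t)\<^sup>2)"
    using tail_second_moment_ge[where n=n and k=k] k(1) by (simp add: S_def)
  then have "ennreal 1 \<le> ennreal (LINT t|circle. (?b t)\<^sup>2)"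
    by (rule ennreal_leI)
  also have "\<dots> = (\<integral>\<^sup>+ t. ennreal ((?b t)\<^sup>2) \<partial>circle)"
    by (rule nn_integral_eq_integral[symmetric])
      (auto intro!: continuous_imp_integrable_circle continuous_intros cont)
  also have "\<dots> \<le> (\<integral>\<^sup>+ t. ennreal (1 / 4 + \<kappa> * (?b t) ^ 4) + ennreal (M / \<theta>) * (?f n t + ?f (n + k) t) \<partial>circle)"
  proof (rule nn_integral_mono)
    fix t assume t: "t \<in> space circle"
    then have ht: "h t \<in> SU11" using h by (simp add: in_Lp_def)
    have "(?b t)\<^sup>2 \<le> 16 * (1 / 8)\<^sup>2 + \<kappa> * (?b t) ^ 4 + 1 / (4 * \<kappa> * ln (1 + 1 / 8) powr p) *
       (rho (g n t) (h t) powr p + rho (g n t ** tail n k t) (h t) powr p)"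
      by (rule offdiag_sq_le(1)[OF partial_prod_in_SU11 tail_in_SU11 ht \<open>0 < p\<close> _ _ \<kappa>]) auto
    also have "1 / (4 * \<kappa> * ln (1 + 1 / 8) powr p) = M / \<theta>"
      using M by (simp add: \<kappa>_def \<theta>_def)
    finally have le: "(?b t)\<^sup>2 \<le> 1 / 4 + \<kappa> * (?b t) ^ 4 +
        M / \<theta> * (rho (g n t) (h t) powr p + rho (g (n + k) t) (h t) powr p)"
      by (simp add: partial_prod_add power2_eq_square)
    have "ennreal (1 / 4 + \<kappa> * (?b t) ^ 4 + M / \<theta> * (rho (g n t) (h t) powr p + rho (g (n + k) t) (h t) powr p))
        = ennreal (1 / 4 + \<kappa> * (?b t) ^ 4) + ennreal (M / \<theta>) * (?f n t + ?f (n + k) t)"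
      using \<kappa> M \<theta> by (intro ennreal_add_mult) auto
    with ennreal_leI[OF le]
    show "ennreal ((?b t)\<^sup>2) \<le> ennreal (1 / 4 + \<kappa> * (?b t) ^ 4) + ennreal (M / \<theta>) * (?f n t + ?f (n + k) t)"
      by simp
  qed
  also have "\<dots> = (\<integral>\<^sup>+ t. ennreal (1 / 4 + \<kappa> * (?b t) ^ 4) \<partial>circle)
      + ennreal (M / \<theta>) * (rho_int p (g n) h + rho_int p (g (n + k)) h)"
  proof -
    have m1: "(\<lambda>t. ennreal (1 / 4 + \<kappa> * (?b t) ^ 4)) \<in> borel_measurable circle"
      by (intro measurable_compose[OF _ measurable_ennreal] continuous_imp_measurable_circle continuous_intros cont)
    note m2 = rho_powr_measurable[OF h]
    have m3: "(\<lambda>t. ?f n t + ?f (n + k) t) \<in> borel_measurable circle"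
      using m2 by measurable
    then have m4: "(\<lambda>t. ennreal (M / \<theta>) * (?f n t + ?f (n + k) t)) \<in> borel_measurable circle"
      by measurable
    show ?thesis
      unfolding rho_int_def nn_integral_add[OF m2 m2, symmetric] nn_integral_cmult[OF m3, symmetric]
      by (rule nn_integral_add[OF m1 m4])
  qed
  also have "\<dots> \<le> ennreal (1 / 2) + ennreal (M / \<theta>) * (ennreal (\<theta> / (8 * M)) + ennreal (\<theta> / (8 * M)))"
  proof (intro add_mono mult_left_mono n(2))
    show "(\<integral>\<^sup>+ t. ennreal (1 / 4 + \<kappa> * (?b t) ^ 4) \<partial>circle) \<le> ennreal (1 / 2)"
    proof (rule nn_integral_circle_le)
      show "continuous_on UNIV (\<lambda>t. 1 / 4 + \<kappa> * (?b t) ^ 4)"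
        by (intro continuous_intros cont)
      show "0 \<le> 1 / 4 + \<kappa> * (?b t) ^ 4" for t using \<kappa> by simp
      have "(LINT t|circle. 1 / 4 + \<kappa> * (?b t) ^ 4) = (LINT t|circle. 1 / 4) + (LINT t|circle. \<kappa> * (?b t) ^ 4)"
        by (intro Bochner_Integration.integral_add continuous_imp_integrable_circle continuous_intros cont)
      also have "\<dots> = 1 / 4 + \<kappa> * (LINT t|circle. (?b t) ^ 4)"
        by simp
      also have "\<dots> \<le> 1 / 4 + \<kappa> * M"
      proof (intro add_left_mono mult_left_mono)
        have "(LINT t|circle. (?b t) ^ 4) \<le> exp (590 * S k)"
          unfolding S_def
        proof (rule tail_fourth_moment_le)
          fix j :: nat assume "1 \<le> j" "j \<le> k"
          then show "cmod (B (n + j)) \<le> 1" using n(1)[of "n + j - 1"] by simp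
        qed
        also have "\<dots> \<le> M"
          using S2 by (simp add: M_def)
        finally show "(LINT t|circle. (?b t) ^ 4) \<le> M" .
      qed (use \<kappa> in simp)
      also have "\<dots> = 1 / 2"
        using M by (simp add: \<kappa>_def)
      finally show "(LINT t|circle. 1 / 4 + \<kappa> * (?b t) ^ 4) \<le> 1 / 2" by simp
    qed simp
  qed auto
  also have "\<dots> = ennreal (1 / 2 + M / \<theta> * (\<theta> / (8 * M) + \<theta> / (8 * M)))"
    using M \<theta> by (intro ennreal_add_mult[symmetric]) auto
  also have "1 / 2 + M / \<theta> * (\<theta> / (8 * M) + \<theta> / (8 * M)) = 3 / 4"
    using M \<theta> by (simp add: field_simps)
  finally show False
    by (subst (asm) ennreal_le_iff) auto
qed

end

section \<open>The logarithmic summability condition and the theorem\<close>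

lemma summable_ln_one_plus_iff:
  fixes f :: "nat \<Rightarrow> real"
  assumes "\<And>j. 0 \<le> f j"
  shows "summable (\<lambda>j. ln (1 + f j)) \<longleftrightarrow> summable f"
proof
  assume sm: "summable (\<lambda>j. ln (1 + f j))"
  then have "(\<lambda>j. ln (1 + f j)) \<longlonglongrightarrow> 0" by (rule summable_LIMSEQ_zero)
  then have "\<forall>\<^sub>F j in sequentially. ln (1 + f j) < ln 2"
    by (rule order_tendstoD) simp
  then have "\<forall>\<^sub>F j in sequentially. norm (f j) \<le> 2 * ln (1 + f j)"
  proof eventually_elim
    case (elim j)
    then have f1: "f j < 1" using assms[of j] by (subst (asm) ln_less_cancel_iff) auto
    \<comment> \<open>Once \<open>f j < 1\<close>, the bound
      \<open>f j / (1 + f j) \<le> ln (1 + f j)\<close> loses only a factor 2.\<close>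
    have "f j / 2 \<le> f j / (1 + f j)"
      using f1 assms[of j] by (intro divide_left_mono) auto
    also have "\<dots> = 1 - inverse (1 + f j)"
      using assms[of j] by (simp add: field_simps)
    also have "\<dots> \<le> ln (1 + f j)"
      using assms[of j] ln_le_minus_one[of "inverse (1 + f j)"] by (simp add: ln_inverse)
    finally show ?case using assms[of j] by simp
  qed
  then show "summable f"
    by (rule summable_comparison_test_ev) (intro summable_mult sm)
next
  assume sm: "summable f"
  show "summable (\<lambda>j. ln (1 + f j))"
  proof (rule summable_comparison_test'[OF sm])
    fix j
    show "norm (ln (1 + f j)) \<le> f j"
      using assms[of j] ln_add_one_self_le_self[of "f j"] by simp
  qed
qed

theorem theorem1p1:
  fixes m :: "nat \<Rightarrow> nat" and A :: "nat \<Rightarrow> real" and B :: "nat \<Rightarrow> complex"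
    and q p :: real
  assumes "q \<ge> 2" and "p > 0"
    and "\<And>j. j \<ge> 1 \<Longrightarrow> m j > 0"
    and "\<And>j. j \<ge> 1 \<Longrightarrow> m j < m (Suc j)"
    and "\<And>j. j \<ge> 1 \<Longrightarrow> real (m (Suc j)) \<ge> q * real (m j)"
    and "\<And>j. j \<ge> 1 \<Longrightarrow> A j > 0"
    and "\<And>j. j \<ge> 1 \<Longrightarrow> (A j)^2 - (cmod (B j))^2 = 1"
  shows "Lp_convergent p (\<lambda>N. partial_prod m A B N)
     \<longleftrightarrow> summable (\<lambda>j. ln ((A (Suc j))^2 + (cmod (B (Suc j)))^2))"
proof -
  have A_sq: "(A j)\<^sup>2 = 1 + (cmod (B j))\<^sup>2" if "1 \<le> j" for j
    using assms(7)[OF that] by simp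
  interpret lacunary_product m A B
  proof
    fix j :: nat assume j: "1 \<le> j"
    have "2 * real (m j) \<le> q * real (m j)"
      using assms(1) by (intro mult_right_mono) auto
    also have "\<dots> \<le> real (m (Suc j))"
      by (rule assms(5)[OF j])
    finally show "2 * m j \<le> m (Suc j)" by linarith
  qed (use assms(3,6) A_sq in auto)
  have eq: "(A (Suc j))\<^sup>2 + (cmod (B (Suc j)))\<^sup>2 = 1 + 2 * (cmod (B (Suc j)))\<^sup>2" for j
    using A_sq[of "Suc j"] by simp
  have "summable (\<lambda>j. ln ((A (Suc j))\<^sup>2 + (cmod (B (Suc j)))\<^sup>2))
      \<longleftrightarrow> summable (\<lambda>j. 2 * (cmod (B (Suc j)))\<^sup>2)"
    unfolding eq by (rule summable_ln_one_plus_iff) simp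
  also have "\<dots> \<longleftrightarrow> summable (\<lambda>j. (cmod (B (Suc j)))\<^sup>2)"
    by (simp add: summable_cmult_iff)
  finally have iff: "summable (\<lambda>j. ln ((A (Suc j))\<^sup>2 + (cmod (B (Suc j)))\<^sup>2))
      \<longleftrightarrow> summable (\<lambda>j. (cmod (B (Suc j)))\<^sup>2)" .
  show ?thesis
    unfolding iff
  proof
    assume "Lp_convergent p (\<lambda>N. partial_prod m A B N)"
    then show "summable (\<lambda>j. (cmod (B (Suc j)))\<^sup>2)"
      by (rule summable_if_convergent[OF _ assms(2)])
  next
    assume "summable (\<lambda>j. (cmod (B (Suc j)))\<^sup>2)"
    then show "Lp_convergent p (\<lambda>N. partial_prod m A B N)"
      by (rule convergent_if_summable[OF _ assms(2)])
  qed
qed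

end
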